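(* Suppose that $\mathcal X$ is compact and that: (i) $\theta^c$ lies in the relative interior of $\Theta$; (ii) $\theta\mapsto\log f(\mathcal S^N|\theta)$ is twice continuously differentiable locally around $\theta^c$; (iii) the Fisher information matrix $\mathcal I(\theta^c)$ is nonsingular; (iv) the prior density $p(\theta)$ is continuous and strictly positive in a neighborhood of $\theta^c$; (v) for all $\theta\in\Theta$, there exists an integrable function $g$ with $|\log f(\xi|\theta)|\le g(\xi)$ and $\mathbb E_{P_{\theta^c}}[g(\xi)]<\infty$, and there exist constants $0<c_1<c_2$ with $c_1\le p(\theta)\le c_2$; (vi) for $j\in\{1,\dots,n\}$, $\mathbb E_{Q_j}[\Phi(\cdot,\xi)]$ and $\mathbb E_{Q_j}[\varphi(\cdot,\xi)]$ are Lipschitz continuous on $\mathcal X$ with moduli $L_{\Phi,j}>0$ and $L_{\varphi,j}>0$, respectively. Then, almost surely, $$\lim_{N\to\infty}\lim_{\lambda\downarrow0}\mathbb D\left(\mathfrak X^\lambda(\hat\theta_N,\hat r_N),\mathfrak X(\theta^c,r^c)\right)=0.$$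
   Context: $\mathcal X\subseteq\mathbb R^d$ is nonempty closed convex with normal cone $\mathcal N_{\mathcal X}(x)=\{v\mid\langle v,y-x\rangle\le0\ \forall y\in\mathcal X\}$. $Q_1,\dots,Q_n$ are fixed probability distributions on $\Xi\subseteq\mathbb R^m$. $\Phi:\mathcal X\times\Xi\to\mathbb R^d$ and $\varphi:\mathcal X\times\Xi\to\mathbb R$ are continuous in $x$ and measurable and $Q_j$-integrable in $\xi$. $\Theta=\{\theta\in\mathbb R^n_+\mid\sum_j\theta_j=1\}$, $\mathbb B(\theta,r)=\{\theta'\mid\|\theta'-\theta\|_\infty\le r\}$. For $\theta\in\Theta$, $r\ge0$, $\lambda\ge0$, $\mathfrak X^\lambda(\theta,r)$ is the set of $x\in\mathcal X$ for which there is $\theta'\in\arg\max_{\theta''\in\mathbb B(\theta,r)\cap\Theta}\{\sum_j\theta''_j\mathbb E_{Q_j}[\varphi(x,\xi)]-\lambda\|\theta''\|^2\}$ (Euclidean norm) with $0\in\sum_j\theta'_j\mathbb E_{Q_j}[\Phi(x,\xi)]+\mathcal N_{\mathcal X}(x)$; $\mathfrak X:=\mathfrak X^0$. $\mathbb D(S_1,S_2)=\sup_{s_1\in S_1}\inf_{s_2\in S_2}\|s_1-s_2\|_\infty$. Statistical setting: $P_\theta=\sum_j\theta_jQ_j$ has density $f(\cdot|\theta)$, distinct parameters giving distinct distributions; $\theta^c\in\Theta$ is the true parameter; $r^c\ge0$ is fixed; $\xi^1,\xi^2,\dots$ are i.i.d. from $P_{\theta^c}$; $\mathcal S^N=\{\xi^1,\dots,\xi^N\}$;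 $f(\mathcal S^N|\theta)=\prod_{i=1}^Nf(\xi^i|\theta)$; $p$ is a prior density on $\Theta$; $\alpha\in(0,1)$. $\hat\theta_N\in\Theta$ is the maximum likelihood estimate, $\mathcal I(\hat\theta_N)=-\frac1N\nabla_\theta^2\log f(\mathcal S^N|\theta)|_{\theta=\hat\theta_N}$, $\Sigma_N=\frac1N\mathcal I(\hat\theta_N)^{-1}$, $\hat\delta_N=\max_j\sqrt{\Sigma_{N,jj}}\,z_{1-\alpha/(2n)}$ ($z_q$ the standard normal $q$-quantile), and $\hat r_N=r^c+\hat\delta_N$. "Almost surely" is with respect to $(P_{\theta^c})^{\mathbb N}$.
   Formalization: The inner limit as λ↓0 is taken as a limit superior, because for fixed N the deviation can oscillate as λ↓0 and the limit need not exist; the two coincide whenever the inner limit exists. *)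

theory Defs
  imports "HOL-Probability.Probability"
begin

definition normal_cone :: "'a::euclidean_space set \<Rightarrow> 'a \<Rightarrow> 'a set" where
  "normal_cone X x = {v. \<forall>y\<in>X. v \<bullet> (y - x) \<le> 0}"

definition prob_simplex :: "(real ^ 'n) set" where
  "prob_simplex = {\<theta>. (\<forall>j. 0 \<le> \<theta> $ j) \<and> (\<Sum>j\<in>UNIV. \<theta> $ j) = 1}"

definition inf_ball :: "real ^ 'n \<Rightarrow> real \<Rightarrow> (real ^ 'n) set" where
  "inf_ball \<theta> r = {\<theta>'. infnorm (\<theta>' - \<theta>) \<le> r}"

definition solution_set ::
  "(real ^ 'd) set \<Rightarrow> ('n \<Rightarrow> (real ^ 'm) measure) \<Rightarrow> (real ^ 'd \<Rightarrow> real ^ 'm \<Rightarrow> real ^ 'd)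
    \<Rightarrow> (real ^ 'd \<Rightarrow> real ^ 'm \<Rightarrow> real) \<Rightarrow> real \<Rightarrow> real ^ 'n \<Rightarrow> real \<Rightarrow> (real ^ 'd) set" where
  "solution_set X Q \<Phi> \<phi> lam \<theta> r =
    {x \<in> X. \<exists>\<theta>'.
        is_arg_max (\<lambda>\<eta>. (\<Sum>j\<in>UNIV. \<eta> $ j * (\<integral>\<xi>. \<phi> x \<xi> \<partial>Q j)) - lam * (norm \<eta>)\<^sup>2)
          (\<lambda>\<eta>. \<eta> \<in> inf_ball \<theta> r \<inter> prob_simplex) \<theta>' \<and>
        0 \<in> (+) (\<Sum>j\<in>UNIV. \<theta>' $ j *\<^sub>R (\<integral>\<xi>. \<Phi> x \<xi> \<partial>Q j)) ` normal_cone X x}"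

text \<open>Values are taken in \<open>ennreal\<close>, so that the supremum over an empty first set is 0 and the
  distance to an empty second set is infinite. For fixed \<open>N\<close> the deviation of the regularized solution
  sets can oscillate as the regularization parameter tends to 0, so the inner limit of an iterated
  limit of deviations is to be taken as \<open>Limsup\<close>; it is the limit whenever the limit exists.\<close>

definition deviation :: "'a::euclidean_space set \<Rightarrow> 'a set \<Rightarrow> ennreal" where
  "deviation S1 S2 = (SUP s1\<in>S1. INF s2\<in>S2. ennreal (infnorm (s1 - s2)))"

text \<open>The measure \<open>P\<^sub>\<theta> = \<Sum>\<^sub>j \<theta>\<^sub>j Q\<^sub>j\<close> on \<open>\<Xi>\<close>, for \<open>\<theta>\<close> in the simplex.\<close>

definition mixture :: "'a::topological_space set \<Rightarrow> ('n::finite \<Rightarrow> 'a measure) \<Rightarrow> real ^ 'n \<Rightarrow> 'a measure" where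
  "mixture \<Xi> Q \<theta> = measure_of \<Xi> (sets (restrict_space borel \<Xi>))
     (\<lambda>A. \<Sum>j\<in>UNIV. ennreal (\<theta> $ j) * emeasure (Q j) A)"

text \<open>A density of \<open>P\<^sub>\<theta>\<close> is determined only up to a null set depending on \<open>\<theta>\<close>. The version used is
  the mixture of fixed component densities \<open>q\<^sub>j\<close> of the \<open>Q\<^sub>j\<close>. As a function of \<open>\<theta>\<close> it is defined on
  all of \<open>\<real>\<^sup>n\<close>, which gives a meaning to the \<open>n \<times> n\<close> Hessians in \<open>\<theta>\<close> although the simplex has empty
  interior. Lemma \<open>mixture_eq_density\<close> below states that it is a density of \<open>P\<^sub>\<theta>\<close>.\<close>

definition mix_density :: "('n::finite \<Rightarrow> 'a \<Rightarrow> real) \<Rightarrow> real ^ 'n \<Rightarrow> 'a \<Rightarrow> real" where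
  "mix_density q \<theta> \<xi> = (\<Sum>j\<in>UNIV. \<theta> $ j * q j \<xi>)"

text \<open>The sample sequence \<open>\<omega>\<close> is indexed from 0, so the first \<open>N\<close> observations are \<open>\<omega> 0, \<dots>, \<omega> (N - 1)\<close>.\<close>

definition likelihood ::
  "('n::finite \<Rightarrow> 'a \<Rightarrow> real) \<Rightarrow> nat \<Rightarrow> (nat \<Rightarrow> 'a) \<Rightarrow> real ^ 'n \<Rightarrow> real" where
  "likelihood q N \<omega> \<theta> = (\<Prod>i<N. mix_density q \<theta> (\<omega> i))"

definition partial_deriv :: "'n \<Rightarrow> (real ^ 'n \<Rightarrow> real) \<Rightarrow> real ^ 'n \<Rightarrow> real" where
  "partial_deriv i F x = deriv (\<lambda>t. F (x + t *\<^sub>R axis i 1)) 0"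

definition hessian :: "(real ^ 'n \<Rightarrow> real) \<Rightarrow> real ^ 'n \<Rightarrow> real ^ 'n ^ 'n" where
  "hessian F x = (\<chi> i j. partial_deriv i (partial_deriv j F) x)"

definition C2_near :: "(real ^ 'n \<Rightarrow> real) \<Rightarrow> real ^ 'n \<Rightarrow> bool" where
  "C2_near F x \<longleftrightarrow> (\<exists>U. open U \<and> x \<in> U \<and> F differentiable_on U \<and>
     (\<forall>j. partial_deriv j F differentiable_on U) \<and>
     (\<forall>i j. continuous_on U (partial_deriv i (partial_deriv j F))))"

text \<open>Fisher information at \<open>\<theta>\<close> in its Hessian form, with expectation under \<open>P = P\<^sub>\<theta>\<close>: the
  population counterpart of the observed information defined next.\<close>

definition fisher_information ::
  "('n::finite \<Rightarrow> 'a \<Rightarrow> real) \<Rightarrow> 'a measure \<Rightarrow> real ^ 'n \<Rightarrow> real ^ 'n ^ 'n" where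
  "fisher_information q P \<theta> =
    (\<chi> i j. \<integral>\<xi>. - (hessian (\<lambda>\<eta>. ln (mix_density q \<eta> \<xi>)) \<theta> $ i $ j) \<partial>P)"

definition observed_information ::
  "('n::finite \<Rightarrow> 'a \<Rightarrow> real) \<Rightarrow> nat \<Rightarrow> (nat \<Rightarrow> 'a) \<Rightarrow> real ^ 'n \<Rightarrow> real ^ 'n ^ 'n" where
  "observed_information q N \<omega> \<theta> =
    - (1 / real N) *\<^sub>R hessian (\<lambda>\<eta>. ln (likelihood q N \<omega> \<eta>)) \<theta>"

definition covariance_estimate ::
  "('n::finite \<Rightarrow> 'a \<Rightarrow> real) \<Rightarrow> nat \<Rightarrow> (nat \<Rightarrow> 'a) \<Rightarrow> real ^ 'n \<Rightarrow> real ^ 'n ^ 'n" where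
  "covariance_estimate q N \<omega> \<theta> = (1 / real N) *\<^sub>R matrix_inv (observed_information q N \<omega> \<theta>)"

definition std_normal_quantile :: "real \<Rightarrow> real" where
  "std_normal_quantile u = Inf {z. u \<le> cdf std_normal_distribution z}"

definition delta_hat ::
  "('n::finite \<Rightarrow> 'a \<Rightarrow> real) \<Rightarrow> real \<Rightarrow> nat \<Rightarrow> (nat \<Rightarrow> 'a) \<Rightarrow> real ^ 'n \<Rightarrow> real" where
  "delta_hat q \<alpha> N \<omega> \<theta> =
    (MAX j. sqrt (covariance_estimate q N \<omega> \<theta> $ j $ j) *
       std_normal_quantile (1 - \<alpha> / (2 * real CARD('n))))"

lemma mixture_eq_density:
  fixes \<Xi> :: "'a::topological_space set" and Q :: "'n::finite \<Rightarrow> 'a measure"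
  assumes sets: "sets \<mu> = sets (restrict_space borel \<Xi>)"
    and q: "\<And>j. q j \<in> borel_measurable \<mu>" "\<And>j \<xi>. \<xi> \<in> \<Xi> \<Longrightarrow> 0 \<le> q j \<xi>"
    and Q: "\<And>j. Q j = density \<mu> (\<lambda>\<xi>. ennreal (q j \<xi>))"
    and \<theta>: "\<theta> \<in> prob_simplex"
  shows "mixture \<Xi> Q \<theta> = density \<mu> (\<lambda>\<xi>. ennreal (mix_density q \<theta> \<xi>))"
proof -
  let ?D = "density \<mu> (\<lambda>\<xi>. ennreal (mix_density q \<theta> \<xi>))"
  have sp: "space \<mu> = \<Xi>"
    using sets_eq_imp_space_eq[OF sets] by (simp add: space_restrict_space)
  have meas: "mix_density q \<theta> \<in> borel_measurable \<mu>"
    unfolding mix_density_def using q(1) by measurable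
  have em: "(\<Sum>j\<in>UNIV. ennreal (\<theta> $ j) * emeasure (Q j) A) = emeasure ?D A" if A: "A \<in> sets \<mu>" for A
  proof -
    have "emeasure ?D A = (\<integral>\<^sup>+\<xi>. (\<Sum>j\<in>UNIV. ennreal (\<theta> $ j) * (ennreal (q j \<xi>) * indicator A \<xi>)) \<partial>\<mu>)"
    proof (subst emeasure_density)
      show "(\<integral>\<^sup>+ \<xi>. ennreal (mix_density q \<theta> \<xi>) * indicator A \<xi> \<partial>\<mu>) =
        (\<integral>\<^sup>+\<xi>. (\<Sum>j\<in>UNIV. ennreal (\<theta> $ j) * (ennreal (q j \<xi>) * indicator A \<xi>)) \<partial>\<mu>)"
      proof (rule nn_integral_cong)
        fix \<xi> assume "\<xi> \<in> space \<mu>"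
        then have "ennreal (mix_density q \<theta> \<xi>) = (\<Sum>j\<in>UNIV. ennreal (\<theta> $ j) * ennreal (q j \<xi>))"
          using q(2) \<theta> unfolding mix_density_def prob_simplex_def sp
          by (auto simp: sum_ennreal[symmetric] ennreal_mult)
        then show "ennreal (mix_density q \<theta> \<xi>) * indicator A \<xi> =
          (\<Sum>j\<in>UNIV. ennreal (\<theta> $ j) * (ennreal (q j \<xi>) * indicator A \<xi>))"
          by (simp add: sum_distrib_right mult.assoc)
      qed
    qed (use meas A in auto)
    also have "\<dots> = (\<Sum>j\<in>UNIV. ennreal (\<theta> $ j) * (\<integral>\<^sup>+\<xi>. ennreal (q j \<xi>) * indicator A \<xi> \<partial>\<mu>))"
      using q(1) A by (subst nn_integral_sum) (auto simp: nn_integral_cmult)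
    also have "\<dots> = (\<Sum>j\<in>UNIV. ennreal (\<theta> $ j) * emeasure (Q j) A)"
      using q(1) A by (simp add: Q emeasure_density)
    finally show ?thesis by simp
  qed
  have "mixture \<Xi> Q \<theta> = measure_of (space \<mu>) (sets \<mu>) (emeasure ?D)"
    unfolding mixture_def sp[symmetric] sets[symmetric, unfolded sp[symmetric]]
    by (rule measure_of_eq) (auto simp: sets.space_closed sets.sigma_sets_eq em)
  also have "\<dots> = ?D"
    using measure_of_of_measure[of ?D] by simp
  finally show ?thesis .
qed

end

theory Submission
  imports Defs
begin

text \<open>
  Write \<open>f\<^sub>c\<close> for the density of \<open>P\<^sub>\<theta>\<close> at the true parameter and \<open>y = (q\<^sub>j / f\<^sub>c)\<^sub>j\<close>. A relative interior
  point of the simplex has positive coordinates, so \<open>y\<close> is bounded, its mean is the all-ones vector,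
  and \<open>\<E> y y\<^sup>T\<close> is the Fisher information; by Hoeffding's inequality and Borel--Cantelli the sample
  means of \<open>y\<close> and \<open>y y\<^sup>T\<close> converge almost surely. For \<open>v = \<theta>\<^sub>N - \<theta>\<^sub>c\<close>, with \<open>\<theta>\<^sub>N\<close> the maximum
  likelihood estimate, the likelihood ratio is \<open>\<Prod>\<^sub>i (1 + v \<bullet> y\<^sub>i) \<ge> 1\<close>, and
  \<open>1 + t \<le> exp (t - t\<^sup>2 / 2M)\<close> bounds the sample mean of \<open>(v \<bullet> y)\<^sup>2\<close> by a multiple of that of \<open>v \<bullet> y\<close>.
  The latter tends to 0 since the coordinates of \<open>v\<close> sum to 0, so every limit point of \<open>v\<close> is
  annihilated by the Fisher quadratic form, which is positive definite. Hence \<open>\<theta>\<^sub>N\<close> is consistent, the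
  observed information converges to the Fisher information, and \<open>\<delta>\<^sub>N\<close> tends to 0.

  It remains to see that the solution sets have closed graph in \<open>(\<lambda>, \<theta>, r)\<close>, which is a compactness
  argument. Solutions need not be shown to exist: if the limiting problem has none, then neither do
  the nearby ones, and the deviation from an empty set is 0.
\<close>

section \<open>Stability of the solution sets\<close>

text \<open>Turns the generalized equation into a variational inequality: a family of weak
  inequalities, one for each \<open>y\<close>, which survives passage to the limit.\<close>

lemma zero_in_translated_normal_cone:
  "0 \<in> (+) v ` normal_cone X x \<longleftrightarrow> (\<forall>y\<in>X. 0 \<le> v \<bullet> (y - x))"
proof -
  have "0 \<in> (+) v ` normal_cone X x \<longleftrightarrow> - v \<in> normal_cone X x"
    using add.inverse_unique by (force simp: image_iff)
  then show ?thesis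
    by (simp add: normal_cone_def)
qed

lemma mem_solution_set_iff:
  "x \<in> solution_set X Q \<Phi> \<phi> l \<theta> r \<longleftrightarrow> x \<in> X \<and>
    (\<exists>\<theta>'. \<theta>' \<in> inf_ball \<theta> r \<inter> prob_simplex \<and>
      (\<forall>\<eta>\<in>inf_ball \<theta> r \<inter> prob_simplex.
        (\<Sum>j\<in>UNIV. \<eta> $ j * (\<integral>\<xi>. \<phi> x \<xi> \<partial>Q j)) - l * (norm \<eta>)\<^sup>2
        \<le> (\<Sum>j\<in>UNIV. \<theta>' $ j * (\<integral>\<xi>. \<phi> x \<xi> \<partial>Q j)) - l * (norm \<theta>')\<^sup>2) \<and>
      (\<forall>y\<in>X. 0 \<le> (\<Sum>j\<in>UNIV. \<theta>' $ j *\<^sub>R (\<integral>\<xi>. \<Phi> x \<xi> \<partial>Q j)) \<bullet> (y - x)))"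
  unfolding solution_set_def zero_in_translated_normal_cone is_arg_max_linorder
  by (simp only: mem_Collect_eq Ball_def conj_assoc)

lemma closed_prob_simplex: "closed (prob_simplex :: (real ^ 'n::finite) set)"
proof -
  have "prob_simplex = (\<Inter>j. {\<theta> :: real ^ 'n. 0 \<le> \<theta> $ j}) \<inter> {\<theta>. (\<Sum>j\<in>UNIV. \<theta> $ j) = 1}"
    by (auto simp: prob_simplex_def)
  also have "closed \<dots>"
    by (intro closed_Int closed_INT closed_Collect_le closed_Collect_eq continuous_intros ballI)
  finally show ?thesis .
qed

lemma prob_simplex_component_le_1:
  "\<theta> \<in> prob_simplex \<Longrightarrow> \<theta> $ j \<le> 1" for \<theta> :: "real ^ 'n::finite"
  using member_le_sum[of j UNIV "\<lambda>j. \<theta> $ j"] by (auto simp: prob_simplex_def)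

lemma compact_prob_simplex: "compact (prob_simplex :: (real ^ 'n::finite) set)"
proof -
  have "norm \<theta> \<le> 1" if "\<theta> \<in> prob_simplex" for \<theta> :: "real ^ 'n"
    using norm_le_l1_cart[of \<theta>] that by (simp add: prob_simplex_def)
  then show ?thesis
    by (auto simp: compact_eq_bounded_closed closed_prob_simplex bounded_iff)
qed

lemma convex_prob_simplex: "convex (prob_simplex :: (real ^ 'n::finite) set)"
  by (auto simp: convex_def prob_simplex_def sum.distrib simp flip: sum_distrib_left)

lemma tendsto_zero_infnormD:
  fixes f :: "'b \<Rightarrow> 'a::euclidean_space"
  assumes "((\<lambda>x. infnorm (f x)) \<longlongrightarrow> 0) F"
  shows "(f \<longlongrightarrow> 0) F"
proof (rule Lim_null_comparison)
  show "((\<lambda>x. sqrt DIM('a) * infnorm (f x)) \<longlongrightarrow> 0) F"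
    using tendsto_mult_left[OF assms] by simp
  show "\<forall>\<^sub>F x in F. norm (f x) \<le> sqrt DIM('a) * infnorm (f x)"
    by (simp add: norm_le_infnorm)
qed

text \<open>Move from \<open>\<theta>s k\<close> towards \<open>\<eta>\<close> along the segment, as
  far as the radius \<open>rs k\<close> permits. Convexity keeps the point in the simplex, and the
  distance still missing is \<open>max 0 (d k - rs k)\<close>, which tends to 0 because
  \<open>\<eta>\<close> lies in the limiting ball.\<close>

lemma inf_ball_simplex_lower_hemicontinuous:
  fixes \<theta> \<eta> :: "real ^ 'n::finite"
  assumes \<theta>s: "\<theta>s \<longlonglongrightarrow> \<theta>" "\<And>k. \<theta>s k \<in> prob_simplex"
    and rs: "rs \<longlonglongrightarrow> r" "\<And>k. 0 \<le> rs k"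
    and \<eta>: "\<eta> \<in> inf_ball \<theta> r \<inter> prob_simplex"
  obtains \<eta>s where "\<eta>s \<longlonglongrightarrow> \<eta>" "\<And>k. \<eta>s k \<in> inf_ball (\<theta>s k) (rs k) \<inter> prob_simplex"
proof -
  define d where "d k = infnorm (\<eta> - \<theta>s k)" for k
  \<comment> \<open>If \<open>d k = 0\<close>, the quotient is 0 by convention and
    \<open>\<eta>s k = \<theta>s k = \<eta>\<close>.\<close>
  define s where "s k = min 1 (rs k / d k)" for k
  define \<eta>s where "\<eta>s k = (1 - s k) *\<^sub>R \<theta>s k + s k *\<^sub>R \<eta>" for k
  have d: "0 \<le> d k" for k
    by (simp add: d_def infnorm_pos_le)
  have s: "0 \<le> s k" "s k \<le> 1" for k
    using d[of k] rs(2)[of k] by (auto simp: s_def)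
  have d_lim: "d \<longlonglongrightarrow> infnorm (\<eta> - \<theta>)"
    unfolding d_def by (intro tendsto_intros \<theta>s)
  have mem: "\<eta>s k \<in> inf_ball (\<theta>s k) (rs k) \<inter> prob_simplex" for k
  proof
    have "\<eta>s k - \<theta>s k = s k *\<^sub>R (\<eta> - \<theta>s k)"
      by (simp add: \<eta>s_def algebra_simps)
    then have "infnorm (\<eta>s k - \<theta>s k) = s k * d k"
      using s[of k] by (simp add: infnorm_mul d_def)
    also have "\<dots> \<le> rs k"
      using d[of k] rs(2)[of k] by (auto simp: s_def min_def field_simps)
    finally show "\<eta>s k \<in> inf_ball (\<theta>s k) (rs k)"
      by (simp add: inf_ball_def)
    show "\<eta>s k \<in> prob_simplex"
      unfolding \<eta>s_def using \<theta>s(2) \<eta> s[of k] by (intro convexD[OF convex_prob_simplex]) auto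
  qed
  have "(\<lambda>k. infnorm (\<eta>s k - \<eta>)) \<longlonglongrightarrow> 0"
  proof (rule real_tendsto_sandwich)
    show "\<forall>\<^sub>F k in sequentially. 0 \<le> infnorm (\<eta>s k - \<eta>)"
      by (simp add: infnorm_pos_le)
    show "\<forall>\<^sub>F k in sequentially. infnorm (\<eta>s k - \<eta>) \<le> max 0 (d k - rs k)"
    proof (rule always_eventually, rule allI)
      fix k
      have "\<eta>s k - \<eta> = (s k - 1) *\<^sub>R (\<eta> - \<theta>s k)"
        by (simp add: \<eta>s_def algebra_simps)
      then have "infnorm (\<eta>s k - \<eta>) = (1 - s k) * d k"
        using s[of k] by (simp add: infnorm_mul d_def)
      also have "\<dots> \<le> max 0 (d k - rs k)"
        using d[of k] rs(2)[of k] by (auto simp: s_def min_def field_simps)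
      finally show "infnorm (\<eta>s k - \<eta>) \<le> max 0 (d k - rs k)" .
    qed
    have "(\<lambda>k. max 0 (d k - rs k)) \<longlonglongrightarrow> max 0 (infnorm (\<eta> - \<theta>) - r)"
      by (intro tendsto_intros d_lim rs)
    then show "(\<lambda>k. max 0 (d k - rs k)) \<longlonglongrightarrow> 0"
      using \<eta> by (simp add: inf_ball_def max_absorb1)
  qed simp
  then have "\<eta>s \<longlonglongrightarrow> \<eta>"
    by (rule LIM_zero_cancel[OF tendsto_zero_infnormD])
  then show ?thesis
    by (rule that) (rule mem)
qed

text \<open>Select a maximizing weight \<open>ts k\<close> for each \<open>xs k\<close> and extract
  a convergent subsequence in the compact simplex. Feasibility and the variational inequality pass
  to the limit by continuity. Maximality of \<open>ts k\<close> can be tested only against weights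
  feasible for index \<open>k\<close>, so a competitor of the limit is first approximated by such
  weights; this is where lower hemicontinuity enters.\<close>

lemma solution_set_closed_graph:
  fixes X :: "(real ^ 'd) set" and Q :: "'n::finite \<Rightarrow> (real ^ 'm) measure"
  assumes "closed X"
    and cont: "\<And>j. continuous_on X (\<lambda>x. \<integral>\<xi>. \<Phi> x \<xi> \<partial>Q j)"
      "\<And>j. continuous_on X (\<lambda>x. \<integral>\<xi>. \<phi> x \<xi> \<partial>Q j)"
    and \<theta>s: "\<theta>s \<longlonglongrightarrow> \<theta>" "\<And>k. \<theta>s k \<in> prob_simplex"
    and rs: "rs \<longlonglongrightarrow> r" and ls: "ls \<longlonglongrightarrow> l"
    and xs: "xs \<longlonglongrightarrow> x" "\<And>k. xs k \<in> solution_set X Q \<Phi> \<phi> (ls k) (\<theta>s k) (rs k)"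
  shows "x \<in> solution_set X Q \<Phi> \<phi> l \<theta> r"
proof -
  define E where "E j x = (\<integral>\<xi>. \<Phi> x \<xi> \<partial>Q j)" for j x
  define e where "e j x = (\<integral>\<xi>. \<phi> x \<xi> \<partial>Q j)" for j x
  define F where "F l x \<eta> = (\<Sum>j\<in>UNIV. \<eta> $ j * e j x) - l * (norm \<eta>)\<^sup>2" for l x and \<eta> :: "real ^ 'n"
  have xX: "xs k \<in> X" for k
    using xs(2)[of k] by (simp add: solution_set_def)
  have x: "x \<in> X"
    using closed_sequentially[OF \<open>closed X\<close>] xX xs(1) by blast
  have Elim: "(\<lambda>k. E j (xs k)) \<longlonglongrightarrow> E j x" for j
    unfolding E_def by (rule continuous_on_tendsto_compose[OF cont(1) xs(1) x]) (simp add: xX)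
  have elim: "(\<lambda>k. e j (xs k)) \<longlonglongrightarrow> e j x" for j
    unfolding e_def by (rule continuous_on_tendsto_compose[OF cont(2) xs(1) x]) (simp add: xX)
  let ?P = "\<lambda>k \<theta>'. \<theta>' \<in> inf_ball (\<theta>s k) (rs k) \<inter> prob_simplex
      \<and> (\<forall>\<eta> \<in> inf_ball (\<theta>s k) (rs k) \<inter> prob_simplex. F (ls k) (xs k) \<eta> \<le> F (ls k) (xs k) \<theta>')
      \<and> (\<forall>y\<in>X. 0 \<le> (\<Sum>j\<in>UNIV. \<theta>' $ j *\<^sub>R E j (xs k)) \<bullet> (y - xs k))"
  have "\<forall>k. \<exists>\<theta>'. ?P k \<theta>'"
    using xs(2) unfolding mem_solution_set_iff F_def E_def e_def by blast
  then have "\<exists>ts. \<forall>k. ?P k (ts k)"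
    by (rule choice)
  then obtain ts where P: "\<forall>k. ?P k (ts k)" ..
  have ts: "ts k \<in> inf_ball (\<theta>s k) (rs k) \<inter> prob_simplex" for k
    using P by blast
  have ts_max: "F (ls k) (xs k) \<eta> \<le> F (ls k) (xs k) (ts k)"
    if "\<eta> \<in> inf_ball (\<theta>s k) (rs k) \<inter> prob_simplex" for k \<eta>
    using P that by blast
  have ts_vi: "0 \<le> (\<Sum>j\<in>UNIV. ts k $ j *\<^sub>R E j (xs k)) \<bullet> (y - xs k)" if "y \<in> X" for k y
    using P that by blast
  obtain t \<sigma> where t: "t \<in> prob_simplex" "strict_mono \<sigma>" "(ts \<circ> \<sigma>) \<longlonglongrightarrow> t"
    using compact_prob_simplex ts unfolding compact_def by (metis IntD2)
  have sub: "(\<lambda>k. f (\<sigma> k)) \<longlonglongrightarrow> a" if "f \<longlonglongrightarrow> a" for f :: "nat \<Rightarrow> 'z::topological_space" and a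
    using LIMSEQ_subseq_LIMSEQ[OF that t(2)] by (simp add: o_def)
  have tlim: "(\<lambda>k. ts (\<sigma> k)) \<longlonglongrightarrow> t"
    using t(3) by (simp add: o_def)
  \<comment> \<open>No sign is assumed for the radii; each ball contains \<open>ts k\<close>, and a
    nonempty ball has nonnegative radius.\<close>
  have rs_nonneg: "0 \<le> rs k" for k
    using ts[of k] infnorm_pos_le[of "ts k - \<theta>s k"] by (auto simp: inf_ball_def)
  have Flim: "(\<lambda>k. F (ls (\<sigma> k)) (xs (\<sigma> k)) (g k)) \<longlonglongrightarrow> F l x \<eta>" if "g \<longlonglongrightarrow> \<eta>" for g \<eta>
    unfolding F_def by (intro tendsto_intros sub elim ls that)
  have "infnorm (t - \<theta>) \<le> r"
  proof (rule LIMSEQ_le[OF _ sub[OF rs]])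
    show "(\<lambda>k. infnorm (ts (\<sigma> k) - \<theta>s (\<sigma> k))) \<longlonglongrightarrow> infnorm (t - \<theta>)"
      by (intro tendsto_intros tlim sub \<theta>s)
  qed (use ts in \<open>auto simp: inf_ball_def\<close>)
  then have mem: "t \<in> inf_ball \<theta> r \<inter> prob_simplex"
    using t(1) by (simp add: inf_ball_def)
  have max: "F l x \<eta> \<le> F l x t" if \<eta>: "\<eta> \<in> inf_ball \<theta> r \<inter> prob_simplex" for \<eta>
  proof -
    obtain \<eta>s where \<eta>s: "\<eta>s \<longlonglongrightarrow> \<eta>" "\<And>k. \<eta>s k \<in> inf_ball (\<theta>s k) (rs k) \<inter> prob_simplex"
      using inf_ball_simplex_lower_hemicontinuous[OF \<theta>s rs rs_nonneg \<eta>] by blast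
    show ?thesis
      using ts_max[OF \<eta>s(2)] LIMSEQ_le[OF Flim[OF sub[OF \<eta>s(1)]] Flim[OF tlim]] by blast
  qed
  have vi: "0 \<le> (\<Sum>j\<in>UNIV. t $ j *\<^sub>R E j x) \<bullet> (y - x)" if "y \<in> X" for y
  proof (rule LIMSEQ_le_const)
    show "(\<lambda>k. (\<Sum>j\<in>UNIV. ts (\<sigma> k) $ j *\<^sub>R E j (xs (\<sigma> k))) \<bullet> (y - xs (\<sigma> k)))
        \<longlonglongrightarrow> (\<Sum>j\<in>UNIV. t $ j *\<^sub>R E j x) \<bullet> (y - x)"
      by (intro tendsto_intros tlim sub Elim xs)
  qed (use ts_vi that in auto)
  show ?thesis
    unfolding mem_solution_set_iff using x mem max vi unfolding F_def E_def e_def by blast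
qed

text \<open>Otherwise there are parameters within \<open>inverse (Suc k)\<close> of the limiting
  ones and solutions \<open>xs k\<close> at distance at least \<open>\<epsilon>\<close> from the
  whole limiting solution set. By compactness of \<open>X\<close> and the closed graph, a
  subsequence converges to a point of that very set.\<close>

lemma deviation_solution_set_le:
  fixes X :: "(real ^ 'd) set" and Q :: "'n::finite \<Rightarrow> (real ^ 'm) measure"
  assumes "compact X"
    and cont: "\<And>j. continuous_on X (\<lambda>x. \<integral>\<xi>. \<Phi> x \<xi> \<partial>Q j)"
      "\<And>j. continuous_on X (\<lambda>x. \<integral>\<xi>. \<phi> x \<xi> \<partial>Q j)"
    and "0 < (\<epsilon> :: real)"
  obtains \<delta> where "0 < \<delta>"
    "\<And>l' \<theta>' r'. \<theta>' \<in> prob_simplex \<Longrightarrow> dist \<theta>' \<theta> < \<delta> \<Longrightarrow> dist r' r < \<delta> \<Longrightarrow> dist l' l < \<delta> \<Longrightarrow>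
      deviation (solution_set X Q \<Phi> \<phi> l' \<theta>' r') (solution_set X Q \<Phi> \<phi> l \<theta> r) \<le> ennreal \<epsilon>"
proof (rule ccontr)
  let ?S = "solution_set X Q \<Phi> \<phi>"
  note \<delta> = that
  assume "\<not> thesis"
  then have bad: "\<exists>l' \<theta>' r'. \<theta>' \<in> prob_simplex \<and> dist \<theta>' \<theta> < \<delta> \<and> dist r' r < \<delta> \<and> dist l' l < \<delta> \<and>
      \<not> deviation (?S l' \<theta>' r') (?S l \<theta> r) \<le> ennreal \<epsilon>" if "0 < \<delta>" for \<delta>
    using that \<delta> by blast
  have "\<exists>l' \<theta>' r' x. \<theta>' \<in> prob_simplex \<and> dist \<theta>' \<theta> < \<delta> \<and> dist r' r < \<delta> \<and> dist l' l < \<delta> \<and>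
      x \<in> ?S l' \<theta>' r' \<and> (\<forall>s\<in>?S l \<theta> r. \<epsilon> \<le> infnorm (x - s))" if \<delta>: "0 < \<delta>" for \<delta>
  proof -
    obtain l' \<theta>' r' where *: "\<theta>' \<in> prob_simplex" "dist \<theta>' \<theta> < \<delta>" "dist r' r < \<delta>" "dist l' l < \<delta>"
      and "\<not> deviation (?S l' \<theta>' r') (?S l \<theta> r) \<le> ennreal \<epsilon>"
      using bad[OF \<delta>] by blast
    then obtain x where x: "x \<in> ?S l' \<theta>' r'"
      "ennreal \<epsilon> < (INF s\<in>?S l \<theta> r. ennreal (infnorm (x - s)))"
      unfolding deviation_def by (auto simp: not_le less_SUP_iff)
    have "\<epsilon> \<le> infnorm (x - s)" if "s \<in> ?S l \<theta> r" for s
      using less_INF_D[OF x(2) that] \<open>0 < \<epsilon>\<close> by (simp add: ennreal_less_iff)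
    with * x(1) show ?thesis by blast
  qed
  then have "\<exists>l' \<theta>' r' x. \<theta>' \<in> prob_simplex \<and> dist \<theta>' \<theta> < inverse (Suc k) \<and>
      dist r' r < inverse (Suc k) \<and> dist l' l < inverse (Suc k) \<and>
      x \<in> ?S l' \<theta>' r' \<and> (\<forall>s\<in>?S l \<theta> r. \<epsilon> \<le> infnorm (x - s))" for k
    by simp
  then obtain ls \<theta>s rs xs where
    \<theta>s: "\<And>k. \<theta>s k \<in> prob_simplex" "\<And>k. dist (\<theta>s k) \<theta> < inverse (Suc k)"
    and rs: "\<And>k. dist (rs k) r < inverse (Suc k)"
    and ls: "\<And>k. dist (ls k) l < inverse (Suc k)"
    and xs: "\<And>k. xs k \<in> ?S (ls k) (\<theta>s k) (rs k)"
      "\<And>k s. s \<in> ?S l \<theta> r \<Longrightarrow> \<epsilon> \<le> infnorm (xs k - s)"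
    by metis
  have lim: "f \<longlonglongrightarrow> a" if "\<And>k. dist (f k) a < inverse (Suc k)"
    for f :: "nat \<Rightarrow> 'z::metric_space" and a
    unfolding tendsto_dist_iff[of f]
    by (rule Lim_null_comparison[OF _ LIMSEQ_inverse_real_of_nat])
      (use that in \<open>auto intro!: always_eventually less_imp_le\<close>)
  have "xs k \<in> X" for k
    using xs(1)[of k] by (simp add: solution_set_def)
  then obtain x \<sigma> where \<sigma>: "x \<in> X" "strict_mono \<sigma>" "(xs \<circ> \<sigma>) \<longlonglongrightarrow> x"
    using \<open>compact X\<close> unfolding compact_def by metis
  \<comment> \<open>If the limiting solution set is empty, the bound in \<open>xs(2)\<close> is
    vacuous and this membership alone is the contradiction.\<close>
  have x: "x \<in> ?S l \<theta> r"
  proof (rule solution_set_closed_graph[OF compact_imp_closed[OF \<open>compact X\<close>] cont])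
    show "(\<theta>s \<circ> \<sigma>) \<longlonglongrightarrow> \<theta>" "(rs \<circ> \<sigma>) \<longlonglongrightarrow> r" "(ls \<circ> \<sigma>) \<longlonglongrightarrow> l"
      by (intro LIMSEQ_subseq_LIMSEQ lim \<theta>s rs ls \<sigma>)+
  qed (use \<sigma> xs \<theta>s in auto)
  have "(\<lambda>k. infnorm (xs (\<sigma> k) - x)) \<longlonglongrightarrow> infnorm (x - x)"
    using \<sigma>(3) by (intro tendsto_intros) (simp add: o_def)
  then have "\<epsilon> \<le> infnorm (x - x)"
    using xs(2)[OF x] by (intro LIMSEQ_le_const) auto
  with \<open>0 < \<epsilon>\<close> show False
    by (simp add: infnorm_0)
qed

text \<open>The threshold \<open>\<delta>\<close> controls all parameters jointly: once
  \<open>\<theta>s k\<close> and \<open>rs k\<close> are within \<open>\<delta>\<close> of their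
  limits, the deviation is at most \<open>\<epsilon>\<close> for every \<open>lam\<close> between 0
  and \<open>\<delta>\<close>, hence so is its \<open>Limsup\<close>.\<close>

lemma Limsup_deviation_tendsto_zero:
  fixes X :: "(real ^ 'd) set" and Q :: "'n::finite \<Rightarrow> (real ^ 'm) measure"
  assumes "compact X"
    and cont: "\<And>j. continuous_on X (\<lambda>x. \<integral>\<xi>. \<Phi> x \<xi> \<partial>Q j)"
      "\<And>j. continuous_on X (\<lambda>x. \<integral>\<xi>. \<phi> x \<xi> \<partial>Q j)"
    and \<theta>s: "\<theta>s \<longlonglongrightarrow> \<theta>" "\<forall>\<^sub>F k in sequentially. \<theta>s k \<in> prob_simplex" and rs: "rs \<longlonglongrightarrow> r"
  shows "(\<lambda>k. Limsup (at_right 0) (\<lambda>lam. deviation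
      (solution_set X Q \<Phi> \<phi> lam (\<theta>s k) (rs k)) (solution_set X Q \<Phi> \<phi> 0 \<theta> r))) \<longlonglongrightarrow> 0"
    (is "?f \<longlonglongrightarrow> 0")
proof (rule order_tendstoI)
  fix a :: ennreal assume "0 < a"
  then obtain \<epsilon> where \<epsilon>: "0 < \<epsilon>" "ennreal \<epsilon> < a"
  proof -
    obtain b where b: "0 < b" "b < a"
      using dense[OF \<open>0 < a\<close>] by blast
    then have "b < \<top>"
      using order_less_le_trans by fastforce
    with b show ?thesis
      using that[of "enn2real b"] by (simp add: enn2real_positive_iff)
  qed
  obtain \<delta> where \<delta>: "0 < \<delta>"
    "\<And>l' \<theta>' r'. \<theta>' \<in> prob_simplex \<Longrightarrow> dist \<theta>' \<theta> < \<delta> \<Longrightarrow> dist r' r < \<delta> \<Longrightarrow> dist l' 0 < \<delta> \<Longrightarrow>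
      deviation (solution_set X Q \<Phi> \<phi> l' \<theta>' r') (solution_set X Q \<Phi> \<phi> 0 \<theta> r) \<le> ennreal \<epsilon>"
    using deviation_solution_set_le[where \<theta> = \<theta> and r = r and l = 0 and X = X and Q = Q and
        \<Phi> = \<Phi> and \<phi> = \<phi>, OF \<open>compact X\<close> cont \<epsilon>(1)] by blast
  have "\<forall>\<^sub>F k in sequentially. dist (\<theta>s k) \<theta> < \<delta>" "\<forall>\<^sub>F k in sequentially. dist (rs k) r < \<delta>"
    by (rule tendstoD[OF \<theta>s(1) \<delta>(1)]) (rule tendstoD[OF rs \<delta>(1)])
  with \<theta>s(2) show "\<forall>\<^sub>F k in sequentially. ?f k < a"
  proof eventually_elim
    case (elim k)
    have "\<forall>\<^sub>F lam in at_right 0. (lam :: real) < \<delta>" "\<forall>\<^sub>F lam in at_right 0. 0 < (lam :: real)"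
      using eventually_at_right_less[of "0::real"] \<delta>(1) eventually_at_right_real[of 0 \<delta>]
      by (auto elim: eventually_mono)
    then have "\<forall>\<^sub>F lam in at_right 0. deviation
      (solution_set X Q \<Phi> \<phi> lam (\<theta>s k) (rs k)) (solution_set X Q \<Phi> \<phi> 0 \<theta> r) \<le> ennreal \<epsilon>"
      by eventually_elim (use elim in \<open>simp add: \<delta>\<close>)
    then have "?f k \<le> ennreal \<epsilon>"
      by (rule Limsup_bounded)
    with \<epsilon>(2) show ?case by simp
  qed
qed simp

section \<open>A strong law of large numbers for bounded variables\<close>

text \<open>The joint law of the coordinates is \<open>PiM I M\<close> itself, which is the product
  of their marginals; this equality characterizes independence.\<close>

lemma indep_vars_PiM_coordinates:
  assumes "\<And>i. i \<in> I \<Longrightarrow> prob_space (M i)" "I \<noteq> {}"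
  shows "prob_space.indep_vars (PiM I M) M (\<lambda>i \<omega>. \<omega> i) I"
proof -
  interpret P: prob_space "PiM I M"
    using assms by (intro prob_space_PiM)
  have "distr (PiM I M) (PiM I M) (\<lambda>x. \<lambda>i\<in>I. x i) = distr (PiM I M) (PiM I M) (\<lambda>x. x)"
    by (rule distr_cong) (auto simp: space_PiM PiE_restrict)
  also have "\<dots> = (\<Pi>\<^sub>M i\<in>I. distr (PiM I M) (M i) (\<lambda>\<omega>. \<omega> i))"
    using assms by (simp add: distr_id distr_PiM_component cong: PiM_cong)
  finally show ?thesis
    using assms by (subst P.indep_vars_iff_distr_eq_PiM') auto
qed

text \<open>Hoeffding's inequality bounds the probability of a deviation of size \<open>e\<close> by
  a geometric sequence in \<open>N\<close>. These probabilities are summable, so Borel-Cantelli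
  excludes infinitely many such deviations almost surely.\<close>

lemma strong_law_bounded:
  fixes f :: "'a \<Rightarrow> real"
  assumes M: "prob_space M"
    and f: "f \<in> borel_measurable M" "\<And>x. x \<in> space M \<Longrightarrow> \<bar>f x\<bar> \<le> B"
  shows "AE \<omega> in (\<Pi>\<^sub>M i\<in>(UNIV::nat set). M).
    (\<lambda>N. (\<Sum>i<N. f (\<omega> i)) / real N) \<longlonglongrightarrow> integral\<^sup>L M f"
proof -
  let ?P = "\<Pi>\<^sub>M i\<in>(UNIV::nat set). M"
  note [measurable] = f(1)
  interpret M: prob_space M by fact
  interpret P: prob_space ?P
    using M by (intro prob_space_PiM)
  \<comment> \<open>The added 1 keeps the interval from \<open>- b\<close> to \<open>b\<close>
    nondegenerate even when \<open>B = 0\<close>, so that the Hoeffding exponent is negative and the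
    geometric ratio is below 1.\<close>
  define b where "b = \<bar>B\<bar> + 1"
  have dist: "distr ?P borel (\<lambda>\<omega>. f (\<omega> i)) = distr M borel f" for i
  proof -
    have "distr ?P borel (\<lambda>\<omega>. f (\<omega> i)) = distr (distr ?P M (\<lambda>\<omega>. \<omega> i)) borel f"
      by (subst distr_distr) (auto simp: o_def)
    then show ?thesis
      using distr_PiM_component[of UNIV "\<lambda>_. M" i] M by simp
  qed
  have mean: "P.expectation (\<lambda>\<omega>. f (\<omega> 0)) = integral\<^sup>L M f"
  proof -
    have "P.expectation (\<lambda>\<omega>. f (\<omega> 0)) = integral\<^sup>L (distr ?P borel (\<lambda>\<omega>. f (\<omega> 0))) (\<lambda>x. x)"
      by (rule integral_distr[symmetric]) simp_all
    also have "\<dots> = integral\<^sup>L M f"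
      unfolding dist by (rule integral_distr) simp_all
    finally show ?thesis .
  qed
  have hoeffding: "P.prob {\<omega>\<in>space ?P. \<bar>(\<Sum>i<N. f (\<omega> i)) / real N - integral\<^sup>L M f\<bar> \<ge> e}
      \<le> 2 * exp (- (2 * e\<^sup>2 / (2 * b)\<^sup>2)) ^ N"
    if "0 < e" "0 < N" for e and N :: nat
  proof -
    have "P.indep_vars (\<lambda>_. M) (\<lambda>i \<omega>. \<omega> i) (UNIV :: nat set)"
      using indep_vars_PiM_coordinates[of UNIV "\<lambda>_. M"] M by simp
    then have "P.indep_vars (\<lambda>_. M) (\<lambda>i \<omega>. \<omega> i) {..<N}"
      by (rule P.indep_vars_subset) simp
    then have ind: "P.indep_vars (\<lambda>_. borel) (\<lambda>i \<omega>. f (\<omega> i)) {..<N}"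
      by (rule P.indep_vars_compose2[where Y = "\<lambda>_. f"]) simp
    interpret H: Hoeffding_ineq_iid ?P "{..<N}" "\<lambda>i \<omega>. f (\<omega> i)" "\<lambda>\<omega>. f (\<omega> 0)" "- b" b
      "integral\<^sup>L M f"
    proof unfold_locales
      have "f (\<omega> 0) \<in> {- b..b}" if "\<omega> \<in> space ?P" for \<omega>
        using f(2)[of "\<omega> 0"] PiE_mem[of \<omega> UNIV "\<lambda>_. space M" 0] that
        by (auto simp: b_def space_PiM)
      then show "AE \<omega> in ?P. f (\<omega> 0) \<in> {- b..b}" by simp
    qed (use ind in \<open>simp_all add: dist mean\<close>)
    have "exp (- (2 * e\<^sup>2 / (2 * b)\<^sup>2)) ^ N = exp (-2 * real N * e\<^sup>2 / (b - - b)\<^sup>2)"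
      by (simp add: exp_of_nat_mult[symmetric])
    then show ?thesis
      using H.Hoeffding_ineq_abs_ge'[of e] that
      by (auto simp: b_def lessThan_empty_iff)
  qed
  have ae: "AE \<omega> in ?P. \<forall>\<^sub>F N in sequentially.
      \<bar>(\<Sum>i<N. f (\<omega> i)) / real N - integral\<^sup>L M f\<bar> < e" if "0 < e" for e
  proof -
    define A where "A N = {\<omega>\<in>space ?P. \<bar>(\<Sum>i<N. f (\<omega> i)) / real N - integral\<^sup>L M f\<bar> \<ge> e}" for N
    have [measurable]: "A N \<in> sets ?P" for N
      unfolding A_def by measurable
    have "summable (\<lambda>N. 2 * exp (- (2 * e\<^sup>2 / (2 * b)\<^sup>2)) ^ N)"
      using that by (intro summable_mult summable_geometric) (simp add: b_def)
    then have "summable (\<lambda>N. P.prob (A N))"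
    proof (rule summable_comparison_test'[where N = 1])
      show "norm (P.prob (A N)) \<le> 2 * exp (- (2 * e\<^sup>2 / (2 * b)\<^sup>2)) ^ N" if "1 \<le> N" for N
        using hoeffding[of e N] \<open>0 < e\<close> that by (simp add: A_def)
    qed
    then have "AE \<omega> in ?P. \<forall>\<^sub>F N in sequentially. \<omega> \<in> space ?P - A N"
      by (intro borel_cantelli_AE1) (auto simp: P.emeasure_eq_measure)
    then show ?thesis
      by eventually_elim (auto simp: A_def elim: eventually_mono)
  qed
  \<comment> \<open>Restricting the tolerance to the countably many values
    \<open>inverse (real (Suc k))\<close> lets the exceptional null sets be united.\<close>
  have "AE \<omega> in ?P. \<forall>k::nat. \<forall>\<^sub>F N in sequentially.
      \<bar>(\<Sum>i<N. f (\<omega> i)) / real N - integral\<^sup>L M f\<bar> < inverse (real (Suc k))"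
    by (intro iffD2[OF AE_all_countable] allI ae) simp
  then show ?thesis
  proof eventually_elim
    fix \<omega> assume *: "\<forall>k::nat. \<forall>\<^sub>F N in sequentially.
      \<bar>(\<Sum>i<N. f (\<omega> i)) / real N - integral\<^sup>L M f\<bar> < inverse (real (Suc k))"
    show "(\<lambda>N. (\<Sum>i<N. f (\<omega> i)) / real N) \<longlonglongrightarrow> integral\<^sup>L M f"
    proof (rule tendstoI)
      fix e :: real assume "0 < e"
      then obtain k where k: "inverse (real (Suc k)) < e"
        using reals_Archimedean by blast
      from *[rule_format, of k]
      show "\<forall>\<^sub>F N in sequentially. dist ((\<Sum>i<N. f (\<omega> i)) / real N) (integral\<^sup>L M f) < e"
        by eventually_elim (use k in \<open>simp add: dist_real_def\<close>)
    qed
  qed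
qed

section \<open>Derivatives of the log likelihood\<close>

lemma mix_density_add_axis:
  fixes \<theta> :: "real ^ 'n::finite"
  shows "mix_density q (\<theta> + t *\<^sub>R axis j 1) \<xi> = mix_density q \<theta> \<xi> + t * q j \<xi>"
proof -
  have "(\<Sum>k\<in>UNIV. axis j 1 $ k * (t * q k \<xi>)) = t * q j \<xi>"
    by (subst sum.remove[of _ j]) (auto simp: axis_def intro!: sum.neutral)
  then show ?thesis
    by (simp add: mix_density_def algebra_simps sum.distrib)
qed

text \<open>Supplies the neighbourhood of \<open>t = 0\<close> on which every factor of the
  likelihood stays positive along a coordinate line. There the logarithm of the product is the sum
  of the logarithms, so derivatives at 0 may be computed from the sum.\<close>

lemma open_positive_lines: "open {t :: real. \<forall>i<N. 0 < m i + t * c i}" for N :: nat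
proof -
  have "{t :: real. \<forall>i<N. 0 < m i + t * c i} = (\<Inter>i\<in>{..<N}. {t. 0 < m i + t * c i})"
    by auto
  also have "open \<dots>"
    by (intro open_INT finite_lessThan ballI open_Collect_less continuous_intros)
  finally show ?thesis .
qed

lemma partial_deriv_ln_likelihood:
  assumes "\<And>i. i < N \<Longrightarrow> 0 < mix_density q \<theta> (\<omega> i)"
  shows "partial_deriv j (\<lambda>\<eta>. ln (likelihood q N \<omega> \<eta>)) \<theta> =
    (\<Sum>i<N. q j (\<omega> i) / mix_density q \<theta> (\<omega> i))"
proof -
  define m where "m i = mix_density q \<theta> (\<omega> i)" for i
  define c where "c i = q j (\<omega> i)" for i
  have "((\<lambda>t. \<Sum>i<N. ln (m i + t * c i)) has_real_derivative (\<Sum>i<N. c i / m i)) (at 0)"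
    using assms by (auto intro!: derivative_eq_intros simp: m_def)
  then have "((\<lambda>t. ln (\<Prod>i<N. m i + t * c i)) has_real_derivative (\<Sum>i<N. c i / m i)) (at 0)"
    by (rule has_field_derivative_transform_within_open[OF _ open_positive_lines[of N m c]])
      (use assms in \<open>auto simp: m_def intro!: ln_prod[symmetric]\<close>)
  then show ?thesis
    by (simp add: partial_deriv_def likelihood_def mix_density_add_axis m_def c_def DERIV_imp_deriv)
qed

text \<open>The density is affine in the parameter, so its own second derivatives vanish and only
  the negative outer product of the scores remains.\<close>

lemma hessian_ln_likelihood:
  assumes "\<And>i. i < N \<Longrightarrow> 0 < mix_density q \<theta> (\<omega> i)"
  shows "hessian (\<lambda>\<eta>. ln (likelihood q N \<omega> \<eta>)) \<theta> $ a $ b =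
    - (\<Sum>i<N. q a (\<omega> i) * q b (\<omega> i) / (mix_density q \<theta> (\<omega> i))\<^sup>2)"
proof -
  define m where "m i = mix_density q \<theta> (\<omega> i)" for i
  define c where "c i = q a (\<omega> i)" for i
  have "((\<lambda>t. \<Sum>i<N. q b (\<omega> i) / (m i + t * c i)) has_real_derivative
      (\<Sum>i<N. - (q b (\<omega> i) * c i / (m i)\<^sup>2))) (at 0)"
    using assms by (force intro!: derivative_eq_intros sum.cong simp: m_def power2_eq_square)
  then have "((\<lambda>t. partial_deriv b (\<lambda>\<eta>. ln (likelihood q N \<omega> \<eta>)) (\<theta> + t *\<^sub>R axis a 1))
      has_real_derivative (\<Sum>i<N. - (q b (\<omega> i) * c i / (m i)\<^sup>2))) (at 0)"
  \<comment> \<open>The inner partial derivative is differentiated again, so its formula is needed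
    at all nearby points of the line and not only at \<open>\<theta>\<close>.\<close>
  proof (rule has_field_derivative_transform_within_open[OF _ open_positive_lines[of N m c]])
    fix t assume "t \<in> {t. \<forall>i<N. 0 < m i + t * c i}"
    then show "(\<Sum>i<N. q b (\<omega> i) / (m i + t * c i)) =
        partial_deriv b (\<lambda>\<eta>. ln (likelihood q N \<omega> \<eta>)) (\<theta> + t *\<^sub>R axis a 1)"
      by (subst partial_deriv_ln_likelihood) (auto simp: mix_density_add_axis m_def c_def)
  qed (use assms in \<open>auto simp: m_def\<close>)
  then show ?thesis
    by (simp add: hessian_def partial_deriv_def[of a] DERIV_imp_deriv sum_negf m_def c_def mult.commute)
qed

lemma hessian_ln_mix_density:
  assumes "0 < mix_density q \<theta> \<xi>"
  shows "hessian (\<lambda>\<eta>. ln (mix_density q \<eta> \<xi>)) \<theta> $ a $ b =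
    - (q a \<xi> * q b \<xi> / (mix_density q \<theta> \<xi>)\<^sup>2)"
  using hessian_ln_likelihood[of 1 q \<theta> "\<lambda>_. \<xi>" a b] assms by (simp add: likelihood_def)

section \<open>Continuity of the matrix inverse and the vanishing radius correction\<close>

lemma tendsto_det:
  fixes f :: "'b \<Rightarrow> real ^ 'n ^ 'n"
  assumes "\<And>i j. ((\<lambda>x. f x $ i $ j) \<longlongrightarrow> A $ i $ j) F"
  shows "((\<lambda>x. det (f x)) \<longlongrightarrow> det A) F"
  unfolding det_def by (intro tendsto_intros assms)

text \<open>Cramer's rule for the linear system with right-hand side \<open>axis j 1\<close>, whose
  solution is column \<open>j\<close> of the inverse. Writing entries as quotients of determinants
  makes their continuity evident.\<close>

lemma matrix_inv_component:
  fixes A :: "real ^ 'n ^ 'n"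
  assumes "det A \<noteq> 0"
  shows "matrix_inv A $ k $ j = det (\<chi> i l. if l = k then axis j 1 $ i else A $ i $ l) / det A"
proof -
  have "A ** matrix_inv A = mat 1"
    using assms unfolding matrix_inv_def invertible_det_nz[symmetric] invertible_def
    by (rule someI2_ex) simp
  then have "A *v (matrix_inv A *v axis j 1) = axis j 1"
    by (simp add: matrix_vector_mul_assoc)
  then have "matrix_inv A *v axis j 1 =
      (\<chi> k. det (\<chi> i l. if l = k then axis j 1 $ i else A $ i $ l) / det A)"
    using cramer[OF assms] by blast
  moreover have "(matrix_inv A *v axis j 1) $ k = matrix_inv A $ k $ j"
    by (simp add: matrix_vector_mul_component inner_axis)
  ultimately show ?thesis
    by simp
qed

lemma tendsto_matrix_inv_component:
  fixes f :: "'b \<Rightarrow> real ^ 'n ^ 'n"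
  assumes f: "\<And>i j. ((\<lambda>x. f x $ i $ j) \<longlongrightarrow> A $ i $ j) F" and "invertible A"
  shows "((\<lambda>x. matrix_inv (f x) $ k $ j) \<longlongrightarrow> matrix_inv A $ k $ j) F"
proof -
  have A: "det A \<noteq> 0"
    using assms by (simp add: invertible_det_nz)
  have "((\<lambda>x. det (\<chi> i l. if l = k then axis j 1 $ i else f x $ i $ l) / det (f x)) \<longlongrightarrow>
      det (\<chi> i l. if l = k then axis j 1 $ i else A $ i $ l) / det A) F"
    using f A by (intro tendsto_divide tendsto_det) auto
  moreover have "\<forall>\<^sub>F x in F. det (f x) \<noteq> 0"
    using tendsto_imp_eventually_ne[OF tendsto_det[OF f] A] .
  then have "\<forall>\<^sub>F x in F. det (\<chi> i l. if l = k then axis j 1 $ i else f x $ i $ l) / det (f x) =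
      matrix_inv (f x) $ k $ j"
    by eventually_elim (simp add: matrix_inv_component)
  ultimately show ?thesis
    using matrix_inv_component[OF A] by (simp add: tendsto_cong)
qed

text \<open>The diagonal of the inverse information converges and carries a factor
  \<open>1 / real N\<close>. The function \<open>sqrt\<close> is extended oddly to negative
  arguments and is continuous on the whole line, so the limit passes through it whatever the sign of
  the diagonal entries.\<close>

lemma delta_hat_tendsto_zero:
  fixes \<theta>s :: "nat \<Rightarrow> real ^ 'n::finite"
  assumes "\<And>a b. (\<lambda>N. observed_information q N \<omega> (\<theta>s N) $ a $ b) \<longlonglongrightarrow> A $ a $ b" "invertible A"
  shows "(\<lambda>N. delta_hat q \<alpha> N \<omega> (\<theta>s N)) \<longlonglongrightarrow> 0"
proof -
  define z where "z = std_normal_quantile (1 - \<alpha> / (2 * real CARD('n)))"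
  define f where "f N j = sqrt (covariance_estimate q N \<omega> (\<theta>s N) $ j $ j) * z" for N j
  have "(\<lambda>N. covariance_estimate q N \<omega> (\<theta>s N) $ j $ j) \<longlonglongrightarrow> 0" for j
    using tendsto_mult[OF lim_1_over_n tendsto_matrix_inv_component[OF assms]]
    by (simp add: covariance_estimate_def)
  then have "(\<lambda>N. f N j) \<longlonglongrightarrow> sqrt 0 * z" for j
    unfolding f_def by (intro tendsto_intros)
  then have "(\<lambda>N. \<Sum>j\<in>UNIV. \<bar>f N j\<bar>) \<longlonglongrightarrow> (\<Sum>j\<in>(UNIV :: 'n set). \<bar>sqrt 0 * z\<bar>)"
    by (intro tendsto_intros)
  then have lim: "(\<lambda>N. \<Sum>j\<in>UNIV. \<bar>f N j\<bar>) \<longlonglongrightarrow> 0"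
    by simp
  \<comment> \<open>The maximum is one of the values \<open>f N j\<close>, so its absolute value is
    dominated by the sum of all of theirs.\<close>
  have "norm (delta_hat q \<alpha> N \<omega> (\<theta>s N)) \<le> (\<Sum>j\<in>UNIV. \<bar>f N j\<bar>)" for N
  proof -
    have "delta_hat q \<alpha> N \<omega> (\<theta>s N) = Max (range (f N))"
      by (simp add: delta_hat_def f_def z_def)
    also have "Max (range (f N)) \<in> range (f N)"
      by (intro Max_in) auto
    finally show ?thesis
      using member_le_sum[of _ UNIV "\<lambda>j. \<bar>f N j\<bar>"] by auto
  qed
  then show ?thesis
    by (intro Lim_null_comparison[OF always_eventually lim] allI)
qed

section \<open>Consistency of the maximum likelihood estimate\<close>

text \<open>From a relative interior point, the segment coming from the vertex
  \<open>axis j 1\<close> can be prolonged slightly inside the simplex. If coordinate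
  \<open>j\<close> were 0, it would become \<open>1 - e < 0\<close> on the prolongation.\<close>

lemma prob_simplex_rel_interior_pos:
  fixes \<theta> :: "real ^ 'n::finite"
  assumes "\<theta> \<in> rel_interior prob_simplex"
  shows "0 < \<theta> $ j"
proof (rule ccontr)
  assume "\<not> 0 < \<theta> $ j"
  moreover have "\<theta> \<in> prob_simplex"
    using assms rel_interior_subset by blast
  ultimately have "\<theta> $ j = 0"
    by (auto simp: prob_simplex_def not_less intro: antisym)
  have v: "axis j 1 \<in> (prob_simplex :: (real ^ 'n) set)"
    by (auto simp: prob_simplex_def axis_def)
  then obtain e where "1 < e" "(1 - e) *\<^sub>R axis j 1 + e *\<^sub>R \<theta> \<in> prob_simplex"
    using assms convex_rel_interior_iff[OF convex_prob_simplex] by blast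
  then have "0 \<le> ((1 - e) *\<^sub>R axis j 1 + e *\<^sub>R \<theta>) $ j"
    unfolding prob_simplex_def by blast
  with \<open>1 < e\<close> \<open>\<theta> $ j = 0\<close> show False
    by (simp add: axis_def)
qed

text \<open>The logarithm of the right side minus that of the left is \<open>h u\<close>, with
  derivative \<open>(x - 1) * (1 / x - 1 / M)\<close>. On the positive reals up to \<open>M\<close>
  the second factor is nonnegative, so \<open>h\<close> is minimal at 1, where it is 0. With
  \<open>u = 1 + t\<close> this bounds one factor of the likelihood ratio; the case
  \<open>u = 0\<close> covers factors that vanish.\<close>

lemma le_exp_quadratic:
  fixes u M :: real
  assumes "0 \<le> u" "u \<le> M" "1 \<le> M"
  shows "u \<le> exp ((u - 1) - (u - 1)\<^sup>2 / (2 * M))"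
proof (cases "u = 0")
  case False
  define h where "h x = (x - 1) - (x - 1)\<^sup>2 / (2 * M) - ln x" for x
  have der: "(h has_real_derivative (x - 1) * (1 / x - 1 / M)) (at x)" if "0 < x" for x
    unfolding h_def using that assms(3)
    by (auto intro!: derivative_eq_intros simp: field_simps power2_eq_square)
  have "h 1 \<le> h u"
  proof (cases "1 \<le> u")
    case True
    show ?thesis
    proof (rule DERIV_nonneg_imp_nondecreasing[OF True])
      show "\<exists>y. (h has_real_derivative y) (at x) \<and> 0 \<le> y" if "1 \<le> x" "x \<le> u" for x
        using der[of x] that assms by (intro exI[of _ "(x - 1) * (1 / x - 1 / M)"]) (auto simp: frac_le)
    qed
  next
    case 1: False
    then have "u \<le> 1"
      by simp
    then show ?thesis
    proof (rule DERIV_nonpos_imp_nonincreasing[of u 1 h])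
      show "\<exists>y. (h has_real_derivative y) (at x) \<and> y \<le> 0" if "u \<le> x" "x \<le> 1" for x
        using der[of x] that assms False
        by (intro exI[of _ "(x - 1) * (1 / x - 1 / M)"])
          (auto simp: frac_le intro!: mult_nonpos_nonneg)
    qed
  qed
  then have "ln u \<le> (u - 1) - (u - 1)\<^sup>2 / (2 * M)"
    by (simp add: h_def)
  then show ?thesis
    using False assms(1) exp_le_cancel_iff[of "ln u"] by simp
qed simp

section \<open>Density ratios and information at the true parameter\<close>

locale mixture_model =
  fixes \<Xi> :: "'a::topological_space set" and Q :: "'n::finite \<Rightarrow> 'a measure"
    and \<mu> :: "'a measure" and q :: "'n \<Rightarrow> 'a \<Rightarrow> real" and \<theta>\<^sub>c :: "real ^ 'n"
  assumes prob_space_Q: "\<And>j. prob_space (Q j)"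
    and sets_\<mu>: "sets \<mu> = sets (restrict_space borel \<Xi>)"
    and q_measurable [measurable]: "\<And>j. q j \<in> borel_measurable \<mu>"
    and q_nonneg: "\<And>j \<xi>. \<xi> \<in> \<Xi> \<Longrightarrow> 0 \<le> q j \<xi>"
    and Q_density: "\<And>j. Q j = density \<mu> (\<lambda>\<xi>. ennreal (q j \<xi>))"
    and \<theta>\<^sub>c_simplex: "\<theta>\<^sub>c \<in> prob_simplex"
    and \<theta>\<^sub>c_pos: "\<And>j. 0 < \<theta>\<^sub>c $ j"
begin

abbreviation P where "P \<equiv> mixture \<Xi> Q \<theta>\<^sub>c"

text \<open>Where the density is positive, this is the score of one observation: the gradient of the
  log density at \<open>\<theta>\<^sub>c\<close>. Where the density vanishes, division by zero makes
  it 0.\<close>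

definition ratio :: "'a \<Rightarrow> real ^ 'n" where
  "ratio \<xi> = (\<chi> j. q j \<xi> / mix_density q \<theta>\<^sub>c \<xi>)"

definition M :: real where "M = (\<Sum>j\<in>UNIV. 1 / \<theta>\<^sub>c $ j)"

text \<open>The outer-product form of the Fisher information. It is not centered: derivatives are
  taken in the ambient space and not along the simplex, so the score has mean 1 in each coordinate
  instead of mean 0.\<close>

definition information :: "real ^ 'n ^ 'n" where
  "information = (\<chi> a b. \<integral>\<xi>. ratio \<xi> $ a * ratio \<xi> $ b \<partial>P)"

lemma space_\<mu>: "space \<mu> = \<Xi>"
  using sets_eq_imp_space_eq[OF sets_\<mu>] by (simp add: space_restrict_space)

lemma P_eq_density: "P = density \<mu> (\<lambda>\<xi>. ennreal (mix_density q \<theta>\<^sub>c \<xi>))"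
  by (rule mixture_eq_density[OF sets_\<mu> q_measurable q_nonneg Q_density \<theta>\<^sub>c_simplex])

lemma space_P: "space P = \<Xi>"
  by (simp add: P_eq_density space_\<mu>)

lemma sets_P: "sets P = sets \<mu>"
  by (simp add: P_eq_density)

lemma mix_density_measurable [measurable]: "mix_density q \<theta> \<in> borel_measurable \<mu>"
  unfolding mix_density_def by measurable

lemma ratio_measurable [measurable]: "(\<lambda>\<xi>. ratio \<xi> $ j) \<in> borel_measurable P"
  unfolding measurable_cong_sets[OF sets_P refl] ratio_def by simp

lemma inverse_\<theta>\<^sub>c_le_M: "1 / \<theta>\<^sub>c $ j \<le> M"
  unfolding M_def by (rule member_le_sum) (auto simp: \<theta>\<^sub>c_pos less_imp_le)

lemma M_ge_1: "1 \<le> M"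
proof -
  have "1 \<le> 1 / \<theta>\<^sub>c $ undefined"
    using prob_simplex_component_le_1[OF \<theta>\<^sub>c_simplex] \<theta>\<^sub>c_pos by simp
  then show ?thesis
    using inverse_\<theta>\<^sub>c_le_M order_trans by blast
qed

lemma mix_density_nonneg: "\<theta> \<in> prob_simplex \<Longrightarrow> \<xi> \<in> \<Xi> \<Longrightarrow> 0 \<le> mix_density q \<theta> \<xi>"
  unfolding mix_density_def prob_simplex_def by (intro sum_nonneg mult_nonneg_nonneg) (auto simp: q_nonneg)

text \<open>The product \<open>\<theta>\<^sub>c $ j * q j \<xi>\<close> is one of the nonnegative
  summands of the mixture density. In particular, all components vanish wherever the mixture density
  does.\<close>

lemma q_le: "\<xi> \<in> \<Xi> \<Longrightarrow> q j \<xi> \<le> M * mix_density q \<theta>\<^sub>c \<xi>"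
proof -
  assume \<xi>: "\<xi> \<in> \<Xi>"
  have "\<theta>\<^sub>c $ j * q j \<xi> \<le> mix_density q \<theta>\<^sub>c \<xi>"
    unfolding mix_density_def using q_nonneg[OF \<xi>] \<theta>\<^sub>c_pos
    by (intro member_le_sum) (auto simp: less_imp_le)
  then have "q j \<xi> \<le> 1 / \<theta>\<^sub>c $ j * mix_density q \<theta>\<^sub>c \<xi>"
    using \<theta>\<^sub>c_pos[of j] by (simp add: field_simps)
  also have "\<dots> \<le> M * mix_density q \<theta>\<^sub>c \<xi>"
    by (intro mult_right_mono inverse_\<theta>\<^sub>c_le_M mix_density_nonneg \<theta>\<^sub>c_simplex \<xi>)
  finally show ?thesis .
qed

lemma ratio_bounds: "\<xi> \<in> \<Xi> \<Longrightarrow> 0 \<le> ratio \<xi> $ j" "\<xi> \<in> \<Xi> \<Longrightarrow> ratio \<xi> $ j \<le> M"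
  using q_le[of \<xi> j] q_nonneg[of \<xi> j] mix_density_nonneg[OF \<theta>\<^sub>c_simplex, of \<xi>] M_ge_1
  by (auto simp: ratio_def divide_le_eq)

lemma mix_density_eq_ratio:
  assumes "0 < mix_density q \<theta>\<^sub>c \<xi>"
  shows "mix_density q \<theta> \<xi> = mix_density q \<theta>\<^sub>c \<xi> * (1 + (\<theta> - \<theta>\<^sub>c) \<bullet> ratio \<xi>)"
proof -
  have "(\<theta> - \<theta>\<^sub>c) \<bullet> ratio \<xi> = (\<Sum>j\<in>UNIV. (\<theta> - \<theta>\<^sub>c) $ j * q j \<xi>) / mix_density q \<theta>\<^sub>c \<xi>"
    by (simp add: inner_vec_def ratio_def sum_divide_distrib)
  also have "(\<Sum>j\<in>UNIV. (\<theta> - \<theta>\<^sub>c) $ j * q j \<xi>) = mix_density q \<theta> \<xi> - mix_density q \<theta>\<^sub>c \<xi>"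
    by (simp add: mix_density_def sum_subtractf algebra_simps)
  finally show ?thesis
    using assms by (simp add: field_simps)
qed

lemma prob_space_P: "prob_space P"
proof
  have "emeasure P (space P) = (\<integral>\<^sup>+\<xi>. (\<Sum>j\<in>UNIV. ennreal (\<theta>\<^sub>c $ j) * ennreal (q j \<xi>)) \<partial>\<mu>)"
    unfolding P_eq_density
    by (subst emeasure_density, simp, simp, rule nn_integral_cong)
      (auto simp: mix_density_def space_\<mu> q_nonneg \<theta>\<^sub>c_pos less_imp_le sum_ennreal[symmetric]
        ennreal_mult simp del: sum_ennreal)
  also have "\<dots> = (\<Sum>j\<in>UNIV. ennreal (\<theta>\<^sub>c $ j) * emeasure (Q j) (space (Q j)))"
    by (subst nn_integral_sum)
      (auto simp: nn_integral_cmult Q_density emeasure_density intro!: sum.cong nn_integral_cong)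
  also have "\<dots> = ennreal (\<Sum>j\<in>UNIV. \<theta>\<^sub>c $ j)"
    by (simp add: prob_space.emeasure_space_1[OF prob_space_Q] sum_ennreal \<theta>\<^sub>c_pos less_imp_le)
  also have "\<dots> = 1"
    using \<theta>\<^sub>c_simplex by (simp add: prob_simplex_def)
  finally show "emeasure P (space P) = 1" .
qed

lemma AE_mix_density_pos: "AE \<xi> in P. 0 < mix_density q \<theta>\<^sub>c \<xi>"
  unfolding P_eq_density by (subst AE_density) (auto simp: ennreal_less_zero_iff)

text \<open>The mixture density cancels against the denominator, leaving the total mass of
  \<open>Q j\<close>. Where it is zero, \<open>q_le\<close> forces \<open>q j\<close> to be zero as
  well, so the cancellation holds everywhere on \<open>\<Xi>\<close>.\<close>

lemma integral_ratio: "(\<integral>\<xi>. ratio \<xi> $ j \<partial>P) = 1"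
proof -
  have "(\<integral>\<xi>. ratio \<xi> $ j \<partial>P) = (\<integral>\<xi>. mix_density q \<theta>\<^sub>c \<xi> *\<^sub>R ratio \<xi> $ j \<partial>\<mu>)"
    unfolding P_eq_density
    by (rule integral_density)
      (auto simp: mix_density_nonneg[OF \<theta>\<^sub>c_simplex] space_\<mu> ratio_def)
  also have "\<dots> = (\<integral>\<xi>. q j \<xi> *\<^sub>R (1 :: real) \<partial>\<mu>)"
  proof (rule Bochner_Integration.integral_cong)
    fix \<xi> assume "\<xi> \<in> space \<mu>"
    then show "mix_density q \<theta>\<^sub>c \<xi> *\<^sub>R ratio \<xi> $ j = q j \<xi> *\<^sub>R 1"
      using q_le[of \<xi> j] q_nonneg[of \<xi> j] by (auto simp: ratio_def space_\<mu>)
  qed simp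
  also have "\<dots> = (\<integral>\<xi>. (1 :: real) \<partial>Q j)"
    unfolding Q_density by (rule integral_density[symmetric]) (auto simp: q_nonneg space_\<mu>)
  also have "\<dots> = 1"
    using prob_space.prob_space[OF prob_space_Q] by simp
  finally show ?thesis .
qed

lemma fisher_information_eq: "fisher_information q P \<theta>\<^sub>c = information"
proof -
  have "(\<integral>\<xi>. - (hessian (\<lambda>\<eta>. ln (mix_density q \<eta> \<xi>)) \<theta>\<^sub>c $ a $ b) \<partial>P) =
      (\<integral>\<xi>. ratio \<xi> $ a * ratio \<xi> $ b \<partial>P)" for a b
  proof (rule Bochner_Integration.integral_cong)
    fix \<xi> assume "\<xi> \<in> space P"
    then have \<xi>: "\<xi> \<in> \<Xi>"
      by (simp add: space_P)
    show "- (hessian (\<lambda>\<eta>. ln (mix_density q \<eta> \<xi>)) \<theta>\<^sub>c $ a $ b) = ratio \<xi> $ a * ratio \<xi> $ b"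
    proof (cases "0 < mix_density q \<theta>\<^sub>c \<xi>")
      case True
      then show ?thesis
        by (simp add: hessian_ln_mix_density ratio_def power2_eq_square)
    next
      \<comment> \<open>At a point of zero density every component vanishes, so the log density is a
        constant function of \<open>\<eta>\<close> and both sides are 0.\<close>
      case False
      then have "q j \<xi> = 0" for j
        using q_le[OF \<xi>, of j] q_nonneg[OF \<xi>, of j] mix_density_nonneg[OF \<theta>\<^sub>c_simplex \<xi>] by simp
      then have "mix_density q \<eta> \<xi> = 0" "ratio \<xi> $ j = 0" for \<eta> j
        by (simp_all add: mix_density_def ratio_def)
      then show ?thesis
        by (simp add: hessian_def partial_deriv_def)
    qed
  qed simp
  then show ?thesis
    by (simp add: fisher_information_def information_def)
qed

lemma integrable_ratio_mult: "integrable P (\<lambda>\<xi>. ratio \<xi> $ a * ratio \<xi> $ b)"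
proof -
  interpret prob_space P by (rule prob_space_P)
  have "norm (ratio \<xi> $ a * ratio \<xi> $ b) \<le> M * M" if "\<xi> \<in> \<Xi>" for \<xi>
    using ratio_bounds[OF that] M_ge_1 by (auto simp: abs_mult intro!: mult_mono)
  then show ?thesis
    by (intro integrable_const_bound[where B = "M * M"]) (auto simp: space_P)
qed

lemma information_mult_vec:
  "(information *v v) $ a = (\<integral>\<xi>. ratio \<xi> $ a * (v \<bullet> ratio \<xi>) \<partial>P)"
proof -
  have "(\<integral>\<xi>. ratio \<xi> $ a * (v \<bullet> ratio \<xi>) \<partial>P) =
      (\<integral>\<xi>. (\<Sum>b\<in>UNIV. v $ b * (ratio \<xi> $ a * ratio \<xi> $ b)) \<partial>P)"
    by (simp add: inner_vec_def sum_distrib_left mult_ac)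
  also have "\<dots> = (\<Sum>b\<in>UNIV. v $ b * (\<integral>\<xi>. ratio \<xi> $ a * ratio \<xi> $ b \<partial>P))"
    by (simp add: integrable_ratio_mult)
  finally show ?thesis
    by (simp add: matrix_vector_mult_def information_def mult.commute)
qed

lemma integrable_ratio_inner: "integrable P (\<lambda>\<xi>. ratio \<xi> $ a * (v \<bullet> ratio \<xi>))"
proof -
  have "integrable P (\<lambda>\<xi>. \<Sum>b\<in>UNIV. v $ b * (ratio \<xi> $ a * ratio \<xi> $ b))"
    by (intro Bochner_Integration.integrable_sum integrable_mult_right integrable_ratio_mult)
  then show ?thesis
    by (simp add: inner_vec_def sum_distrib_left mult_ac)
qed

text \<open>The quadratic form is the second moment of \<open>v \<bullet> ratio \<xi>\<close>. If it
  is 0, this variable vanishes almost surely, so \<open>information *v v\<close>, the mean of its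
  product with the score, is 0, contrary to invertibility.\<close>

lemma information_pos_def:
  assumes "invertible information" "v \<noteq> 0"
  shows "0 < v \<bullet> (information *v v)"
proof -
  have sq: "(v \<bullet> ratio \<xi>)\<^sup>2 = (\<Sum>a\<in>UNIV. v $ a * (ratio \<xi> $ a * (v \<bullet> ratio \<xi>)))" for \<xi>
    by (simp add: power2_eq_square inner_vec_def[of v "ratio \<xi>"] sum_distrib_right mult.assoc)
  have int: "integrable P (\<lambda>\<xi>. (v \<bullet> ratio \<xi>)\<^sup>2)"
    unfolding sq by (intro Bochner_Integration.integrable_sum integrable_mult_right integrable_ratio_inner)
  have quad: "v \<bullet> (information *v v) = (\<integral>\<xi>. (v \<bullet> ratio \<xi>)\<^sup>2 \<partial>P)"
    unfolding sq
    by (simp add: integrable_ratio_inner inner_vec_def[of v "information *v v"] information_mult_vec)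
  have "v \<bullet> (information *v v) \<noteq> 0"
  proof
    assume "v \<bullet> (information *v v) = 0"
    then have ae: "AE \<xi> in P. v \<bullet> ratio \<xi> = 0"
      unfolding quad using integral_nonneg_eq_0_iff_AE[OF int] by simp
    have "(information *v v) $ a = 0" for a
      unfolding information_mult_vec
      by (rule integral_eq_zero_AE) (use ae in eventually_elim, simp)
    then have "information *v v = 0"
      by (simp add: vec_eq_iff)
    with assms show False
      using matrix_left_invertible_ker[of information] by (auto simp: invertible_left_inverse)
  qed
  moreover have "0 \<le> v \<bullet> (information *v v)"
    unfolding quad by simp
  ultimately show ?thesis
    by simp
qed

text \<open>Dividing by the positive likelihood at \<open>\<theta>\<^sub>c\<close> gives a product
  of factors \<open>1 + t i\<close> that is at least 1; each factor lies between 0 and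
  \<open>M\<close>, so \<open>le_exp_quadratic\<close> applies and the exponents have nonnegative
  sum. Staying with products avoids logarithms of factors not yet known to be positive.\<close>

lemma likelihood_ge_imp_quadratic:
  assumes \<omega>: "\<And>i. i < N \<Longrightarrow> \<omega> i \<in> \<Xi>" "\<And>i. i < N \<Longrightarrow> 0 < mix_density q \<theta>\<^sub>c (\<omega> i)"
    and \<theta>: "\<theta> \<in> prob_simplex" "likelihood q N \<omega> \<theta>\<^sub>c \<le> likelihood q N \<omega> \<theta>"
  shows "(\<Sum>i<N. ((\<theta> - \<theta>\<^sub>c) \<bullet> ratio (\<omega> i))\<^sup>2) / (2 * M) \<le> (\<Sum>i<N. (\<theta> - \<theta>\<^sub>c) \<bullet> ratio (\<omega> i))"
proof -
  define t where "t i = (\<theta> - \<theta>\<^sub>c) \<bullet> ratio (\<omega> i)" for i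
  have mix: "mix_density q \<theta> (\<omega> i) = mix_density q \<theta>\<^sub>c (\<omega> i) * (1 + t i)" if "i < N" for i
    unfolding t_def by (rule mix_density_eq_ratio[OF \<omega>(2)[OF that]])
  have t: "0 \<le> 1 + t i" "1 + t i \<le> M" if i: "i < N" for i
  proof -
    show "0 \<le> 1 + t i"
      using mix_density_nonneg[OF \<theta>(1) \<omega>(1)[OF i]] \<omega>(2)[OF i] mix[OF i]
      by (simp add: zero_le_mult_iff)
    have "mix_density q \<theta> (\<omega> i) \<le> (\<Sum>j\<in>UNIV. \<theta> $ j * (M * mix_density q \<theta>\<^sub>c (\<omega> i)))"
      unfolding mix_density_def[of q \<theta>] using \<theta>(1)
      by (intro sum_mono mult_left_mono q_le \<omega> i) (auto simp: prob_simplex_def)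
    also have "\<dots> = M * mix_density q \<theta>\<^sub>c (\<omega> i)"
      using \<theta>(1) by (simp add: prob_simplex_def flip: sum_distrib_right)
    finally show "1 + t i \<le> M"
      using \<omega>(2)[OF i] mix[OF i] by (simp add: mult.commute)
  qed
  have "0 < likelihood q N \<omega> \<theta>\<^sub>c"
    unfolding likelihood_def by (intro prod_pos) (use \<omega> in auto)
  moreover have "likelihood q N \<omega> \<theta> = likelihood q N \<omega> \<theta>\<^sub>c * (\<Prod>i<N. 1 + t i)"
    by (simp add: likelihood_def mix flip: prod.distrib)
  ultimately have "1 \<le> (\<Prod>i<N. 1 + t i)"
    using \<theta>(2) by simp
  also have "\<dots> \<le> (\<Prod>i<N. exp (t i - (t i)\<^sup>2 / (2 * M)))"
  proof (rule prod_mono)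
    show "0 \<le> 1 + t i \<and> 1 + t i \<le> exp (t i - (t i)\<^sup>2 / (2 * M))" if "i \<in> {..<N}" for i
      using le_exp_quadratic[of "1 + t i" M] t[of i] that M_ge_1 by simp
  qed
  also have "\<dots> = exp (\<Sum>i<N. t i - (t i)\<^sup>2 / (2 * M))"
    by (simp add: exp_sum)
  finally have "0 \<le> (\<Sum>i<N. t i - (t i)\<^sup>2 / (2 * M))"
    by simp
  then show ?thesis
    by (simp add: t_def sum_subtractf sum_divide_distrib)
qed

end

section \<open>Deterministic convergence along one sample path with the almost sure
  properties\<close>

locale typical_sample = mixture_model +
  fixes \<omega> :: "nat \<Rightarrow> 'a"
  assumes \<omega>_mem: "\<And>i. \<omega> i \<in> \<Xi>"
    and \<omega>_pos: "\<And>i. 0 < mix_density q \<theta>\<^sub>c (\<omega> i)"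
    and mean_ratio: "\<And>j. (\<lambda>N. (\<Sum>i<N. ratio (\<omega> i) $ j) / real N) \<longlonglongrightarrow> 1"
    and mean_ratio_mult: "\<And>a b. (\<lambda>N. (\<Sum>i<N. ratio (\<omega> i) $ a * ratio (\<omega> i) $ b) / real N)
      \<longlonglongrightarrow> information $ a $ b"
begin

text \<open>If the estimates stay away from \<open>\<theta>\<^sub>c\<close> along a subsequence,
  compactness yields a limit difference \<open>v \<noteq> 0\<close>. The quadratic bound is
  polynomial in the difference, so its coordinates factor out of the sample means: convergence of
  finitely many means suffices although the estimate depends on the sample.\<close>

lemma maximum_likelihood_consistent:
  assumes inv: "invertible information"
    and \<theta>s: "\<And>N. 1 \<le> N \<Longrightarrow> \<theta>s N \<in> prob_simplex"
      "\<And>N. 1 \<le> N \<Longrightarrow> likelihood q N \<omega> \<theta>\<^sub>c \<le> likelihood q N \<omega> (\<theta>s N)"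
  shows "\<theta>s \<longlonglongrightarrow> \<theta>\<^sub>c"
proof (rule ccontr)
  assume "\<not> \<theta>s \<longlonglongrightarrow> \<theta>\<^sub>c"
  then obtain e where "0 < e" and e: "\<not> (\<forall>\<^sub>F N in sequentially. dist (\<theta>s N) \<theta>\<^sub>c < e)"
    by (auto simp: tendsto_iff)
  obtain \<rho> :: "nat \<Rightarrow> nat" where \<rho>: "strict_mono \<rho>" "\<forall>k. \<not> dist (\<theta>s (\<rho> k)) \<theta>\<^sub>c < e"
    using not_eventually_sequentiallyD[OF e] by auto
  \<comment> \<open>The shift by \<open>Suc\<close> skips a possible \<open>\<rho> 0 = 0\<close>, as
    nothing is known about the estimate from an empty sample.\<close>
  have \<rho>_ge: "1 \<le> \<rho> (Suc k)" for k
    using seq_suble[OF \<rho>(1), of "Suc k"] by simp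
  then have "\<theta>s (\<rho> (Suc k)) \<in> prob_simplex" for k
    by (rule \<theta>s)
  then obtain \<theta> \<sigma> where \<theta>: "\<theta> \<in> prob_simplex" "strict_mono \<sigma>"
    "((\<lambda>k. \<theta>s (\<rho> (Suc k))) \<circ> \<sigma>) \<longlonglongrightarrow> \<theta>"
    using seq_compactE[OF compact_prob_simplex[unfolded compact_eq_seq_compact_metric]] by metis
  define \<kappa> where "\<kappa> k = \<rho> (Suc (\<sigma> k))" for k
  have \<kappa>_mono: "strict_mono \<kappa>"
    using \<rho>(1) \<theta>(2) by (simp add: \<kappa>_def strict_mono_def)
  have lim: "(\<lambda>k. \<theta>s (\<kappa> k)) \<longlonglongrightarrow> \<theta>"
    using \<theta>(3) by (simp add: \<kappa>_def o_def)
  define v where "v = \<theta> - \<theta>\<^sub>c"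
  define vs where "vs k = \<theta>s (\<kappa> k) - \<theta>\<^sub>c" for k
  have vs: "(\<lambda>k. vs k) \<longlonglongrightarrow> v"
    unfolding v_def vs_def by (intro tendsto_intros lim)
  have "e \<le> dist \<theta> \<theta>\<^sub>c"
  proof (rule LIMSEQ_le_const)
    show "(\<lambda>k. dist (\<theta>s (\<kappa> k)) \<theta>\<^sub>c) \<longlonglongrightarrow> dist \<theta> \<theta>\<^sub>c"
      by (intro tendsto_intros lim)
  qed (use \<rho>(2) in \<open>auto simp: \<kappa>_def not_less\<close>)
  with \<open>0 < e\<close> have "v \<noteq> 0"
    by (auto simp: v_def)
  have le: "(\<Sum>a\<in>UNIV. \<Sum>b\<in>UNIV. vs k $ a * vs k $ b *
        ((\<Sum>i<\<kappa> k. ratio (\<omega> i) $ a * ratio (\<omega> i) $ b) / real (\<kappa> k))) / (2 * M)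
      \<le> (\<Sum>j\<in>UNIV. vs k $ j * ((\<Sum>i<\<kappa> k. ratio (\<omega> i) $ j) / real (\<kappa> k)))" (is "?l k \<le> ?r k") for k
  proof -
    have "?l k = (\<Sum>i<\<kappa> k. (vs k \<bullet> ratio (\<omega> i))\<^sup>2) / (2 * M) / real (\<kappa> k)"
    proof -
      have "(\<Sum>a\<in>UNIV. \<Sum>b\<in>UNIV. vs k $ a * vs k $ b *
          ((\<Sum>i<\<kappa> k. ratio (\<omega> i) $ a * ratio (\<omega> i) $ b) / real (\<kappa> k)))
        = (\<Sum>i<\<kappa> k. \<Sum>a\<in>UNIV. \<Sum>b\<in>UNIV. vs k $ a * vs k $ b * (ratio (\<omega> i) $ a * ratio (\<omega> i) $ b))
          / real (\<kappa> k)"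
        unfolding sum.swap[of _ UNIV "{..<\<kappa> k}"] sum_divide_distrib sum_distrib_left by simp
      also have "\<dots> = (\<Sum>i<\<kappa> k. (vs k \<bullet> ratio (\<omega> i))\<^sup>2) / real (\<kappa> k)"
        by (simp add: inner_vec_def power2_eq_square sum_product mult_ac)
      finally show ?thesis
        by simp
    qed
    also have "\<dots> \<le> (\<Sum>i<\<kappa> k. vs k \<bullet> ratio (\<omega> i)) / real (\<kappa> k)"
      using \<rho>_ge[of "\<sigma> k"] unfolding vs_def \<kappa>_def
      by (intro divide_right_mono likelihood_ge_imp_quadratic \<theta>s \<omega>_mem \<omega>_pos) auto
    also have "\<dots> = ?r k"
      unfolding inner_vec_def sum.swap[of _ UNIV "{..<\<kappa> k}"] sum_divide_distrib sum_distrib_left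
      by simp
    finally show ?thesis .
  qed
  have sub: "(\<lambda>k. f (\<kappa> k)) \<longlonglongrightarrow> c" if "f \<longlonglongrightarrow> c" for f :: "nat \<Rightarrow> real" and c
    using LIMSEQ_subseq_LIMSEQ[OF that \<kappa>_mono] by (simp add: o_def)
  have "?l \<longlonglongrightarrow> (\<Sum>a\<in>UNIV. \<Sum>b\<in>UNIV. v $ a * v $ b * information $ a $ b) / (2 * M)"
    using M_ge_1 by (intro tendsto_intros vs sub[OF mean_ratio_mult]) auto
  moreover have "?r \<longlonglongrightarrow> (\<Sum>j\<in>UNIV. v $ j * 1)"
    by (intro tendsto_intros vs sub[OF mean_ratio])
  ultimately have "(\<Sum>a\<in>UNIV. \<Sum>b\<in>UNIV. v $ a * v $ b * information $ a $ b) / (2 * M)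
      \<le> (\<Sum>j\<in>UNIV. v $ j * 1)"
    using le by (intro LIMSEQ_le) auto
  \<comment> \<open>Since the score has mean 1 in each coordinate, the linear term tends to the
    coordinate sum of \<open>v\<close>, a difference of two points of the simplex.\<close>
  also have "(\<Sum>j\<in>UNIV. v $ j * 1) = 0"
    using \<theta>(1) \<theta>\<^sub>c_simplex by (simp add: v_def prob_simplex_def sum_subtractf)
  also have "(\<Sum>a\<in>UNIV. \<Sum>b\<in>UNIV. v $ a * v $ b * information $ a $ b) = v \<bullet> (information *v v)"
    by (simp add: inner_vec_def matrix_vector_mult_def sum_distrib_left mult_ac)
  finally show False
    using information_pos_def[OF inv \<open>v \<noteq> 0\<close>] M_ge_1 by (simp add: divide_le_0_iff)
qed

text \<open>Replacing \<open>\<theta>\<^sub>c\<close> by the estimate multiplies the density at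
  observation \<open>i\<close> by \<open>1 + t i\<close>. The bound on the ratios gives
  \<open>\<bar>t i\<bar> \<le> \<tau> N\<close> for all \<open>i\<close> at once, and the summands
  \<open>r i\<close> are nonnegative, so the observed information is squeezed between two multiples
  of the sample mean \<open>A N\<close> whose factors tend to 1.\<close>

lemma observed_information_tendsto:
  assumes \<theta>s: "\<theta>s \<longlonglongrightarrow> \<theta>\<^sub>c"
  shows "(\<lambda>N. observed_information q N \<omega> (\<theta>s N) $ a $ b) \<longlonglongrightarrow> information $ a $ b"
proof -
  define \<tau> where "\<tau> N = (\<Sum>j\<in>UNIV. \<bar>(\<theta>s N - \<theta>\<^sub>c) $ j\<bar> * M)" for N
  define r where "r i = ratio (\<omega> i) $ a * ratio (\<omega> i) $ b" for i
  define A where "A N = (\<Sum>i<N. r i) / real N" for N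
  have r: "0 \<le> r i" for i
    by (simp add: r_def ratio_bounds \<omega>_mem)
  have "\<tau> \<longlonglongrightarrow> (\<Sum>j\<in>UNIV. \<bar>(\<theta>\<^sub>c - \<theta>\<^sub>c) $ j\<bar> * M)"
    unfolding \<tau>_def by (intro tendsto_intros \<theta>s)
  then have \<tau>_lim: "\<tau> \<longlonglongrightarrow> 0"
    by simp
  have A_lim: "A \<longlonglongrightarrow> information $ a $ b"
    unfolding A_def r_def by (rule mean_ratio_mult)
  have bounds: "A N / (1 + \<tau> N)\<^sup>2 \<le> observed_information q N \<omega> (\<theta>s N) $ a $ b \<and>
      observed_information q N \<omega> (\<theta>s N) $ a $ b \<le> A N / (1 - \<tau> N)\<^sup>2" if "\<tau> N < 1" for N
  proof -
    define t where "t i = (\<theta>s N - \<theta>\<^sub>c) \<bullet> ratio (\<omega> i)" for i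
    have "\<bar>t i\<bar> \<le> \<tau> N" for i
    proof -
      have "\<bar>t i\<bar> \<le> (\<Sum>j\<in>UNIV. \<bar>(\<theta>s N - \<theta>\<^sub>c) $ j * ratio (\<omega> i) $ j\<bar>)"
        unfolding t_def inner_vec_def inner_real_def by (rule sum_abs)
      also have "\<dots> \<le> \<tau> N"
        unfolding \<tau>_def abs_mult
        by (intro sum_mono mult_left_mono) (use ratio_bounds[OF \<omega>_mem] in auto)
      finally show ?thesis .
    qed
    then have t: "- \<tau> N \<le> t i" "t i \<le> \<tau> N" for i
      by (simp_all add: abs_le_iff minus_le_iff)
    have pos: "0 < 1 + t i" for i
      using t(1)[of i] that by simp
    have mix: "mix_density q (\<theta>s N) (\<omega> i) = mix_density q \<theta>\<^sub>c (\<omega> i) * (1 + t i)" for i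
      unfolding t_def by (rule mix_density_eq_ratio[OF \<omega>_pos])
    have "observed_information q N \<omega> (\<theta>s N) $ a $ b =
        (\<Sum>i<N. q a (\<omega> i) * q b (\<omega> i) / (mix_density q (\<theta>s N) (\<omega> i))\<^sup>2) / real N"
      unfolding observed_information_def
      by (simp add: hessian_ln_likelihood mix pos \<omega>_pos)
    also have "\<dots> = (\<Sum>i<N. r i / (1 + t i)\<^sup>2) / real N"
      by (simp add: mix ratio_def r_def power2_eq_square mult_ac)
    finally have eq: "observed_information q N \<omega> (\<theta>s N) $ a $ b = (\<Sum>i<N. r i / (1 + t i)\<^sup>2) / real N" .
    have "A N / (1 + \<tau> N)\<^sup>2 = (\<Sum>i<N. r i / (1 + \<tau> N)\<^sup>2) / real N"
      by (simp add: A_def flip: sum_divide_distrib)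
    also have "\<dots> \<le> (\<Sum>i<N. r i / (1 + t i)\<^sup>2) / real N"
      using t pos by (intro divide_right_mono sum_mono divide_left_mono power_mono r mult_pos_pos zero_less_power)
        (auto intro: less_le_trans[OF pos] less_imp_le)
    finally have 1: "A N / (1 + \<tau> N)\<^sup>2 \<le> (\<Sum>i<N. r i / (1 + t i)\<^sup>2) / real N" .
    have "(\<Sum>i<N. r i / (1 + t i)\<^sup>2) / real N \<le> (\<Sum>i<N. r i / (1 - \<tau> N)\<^sup>2) / real N"
    proof (intro divide_right_mono sum_mono divide_left_mono power_mono r mult_pos_pos zero_less_power pos)
      show "1 - \<tau> N \<le> 1 + t i" for i
        using t(1)[of i] by simp
    qed (use that in auto)
    also have "\<dots> = A N / (1 - \<tau> N)\<^sup>2"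
      by (simp add: A_def flip: sum_divide_distrib)
    finally show ?thesis
      using 1 eq by simp
  qed
  have ev: "\<forall>\<^sub>F N in sequentially. \<tau> N < 1"
    using order_tendstoD(2)[OF \<tau>_lim] by simp
  show ?thesis
  proof (rule real_tendsto_sandwich)
    show "\<forall>\<^sub>F N in sequentially. A N / (1 + \<tau> N)\<^sup>2 \<le> observed_information q N \<omega> (\<theta>s N) $ a $ b"
      "\<forall>\<^sub>F N in sequentially. observed_information q N \<omega> (\<theta>s N) $ a $ b \<le> A N / (1 - \<tau> N)\<^sup>2"
      by (rule eventually_mono[OF ev], simp add: bounds)+
    have "(\<lambda>N. A N / (1 + \<tau> N)\<^sup>2) \<longlonglongrightarrow> information $ a $ b / (1 + 0)\<^sup>2"
      "(\<lambda>N. A N / (1 - \<tau> N)\<^sup>2) \<longlonglongrightarrow> information $ a $ b / (1 - 0)\<^sup>2"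
      by (intro tendsto_intros A_lim \<tau>_lim, simp)+
    then show "(\<lambda>N. A N / (1 + \<tau> N)\<^sup>2) \<longlonglongrightarrow> information $ a $ b"
      "(\<lambda>N. A N / (1 - \<tau> N)\<^sup>2) \<longlonglongrightarrow> information $ a $ b"
      by simp_all
  qed
qed

end

text \<open>The ratios are bounded by \<open>M\<close> and their products by \<open>M * M\<close>,
  so the strong law applies to each. There are finitely many means and countably many positivity
  conditions, hence one null set serves for all.\<close>

lemma (in mixture_model) AE_typical_sample:
  "AE \<omega> in (\<Pi>\<^sub>M i\<in>(UNIV :: nat set). P). typical_sample \<Xi> Q \<mu> q \<theta>\<^sub>c \<omega>"
proof -
  have pos: "AE \<omega> in (\<Pi>\<^sub>M i\<in>(UNIV :: nat set). P). \<forall>i. 0 < mix_density q \<theta>\<^sub>c (\<omega> i)"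
    unfolding AE_all_countable
    by (intro allI AE_PiM_component[where M = "\<lambda>_. P"] prob_space_P AE_mix_density_pos) simp
  have "AE \<omega> in (\<Pi>\<^sub>M i\<in>(UNIV :: nat set). P).
      (\<lambda>N. (\<Sum>i<N. ratio (\<omega> i) $ j) / real N) \<longlonglongrightarrow> (\<integral>\<xi>. ratio \<xi> $ j \<partial>P)" for j
    by (rule strong_law_bounded[OF prob_space_P, of _ M])
      (use ratio_bounds in \<open>auto simp: space_P\<close>)
  then have mean: "AE \<omega> in (\<Pi>\<^sub>M i\<in>(UNIV :: nat set). P).
      \<forall>j. (\<lambda>N. (\<Sum>i<N. ratio (\<omega> i) $ j) / real N) \<longlonglongrightarrow> 1"
    by (intro eventually_all_finite) (simp add: integral_ratio)
  have "AE \<omega> in (\<Pi>\<^sub>M i\<in>(UNIV :: nat set). P).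
      (\<lambda>N. (\<Sum>i<N. ratio (\<omega> i) $ a * ratio (\<omega> i) $ b) / real N)
        \<longlonglongrightarrow> (\<integral>\<xi>. ratio \<xi> $ a * ratio \<xi> $ b \<partial>P)" for a b
    by (rule strong_law_bounded[OF prob_space_P, of _ "M * M"])
      (use ratio_bounds M_ge_1 in \<open>auto simp: space_P abs_mult intro!: mult_mono\<close>)
  then have mean2: "AE \<omega> in (\<Pi>\<^sub>M i\<in>(UNIV :: nat set). P).
      \<forall>a b. (\<lambda>N. (\<Sum>i<N. ratio (\<omega> i) $ a * ratio (\<omega> i) $ b) / real N) \<longlonglongrightarrow> information $ a $ b"
    by (intro eventually_all_finite) (simp add: information_def)
  show ?thesis
    using AE_space pos mean mean2
  proof eventually_elim
    case (elim \<omega>)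
    show ?case
      by unfold_locales (use elim in \<open>auto simp: space_PiM space_P\<close>)
  qed
qed

theorem theorem5:
  fixes X :: "(real ^ 'd) set"
    and \<Xi> :: "(real ^ 'm) set"
    and Q :: "'n::finite \<Rightarrow> (real ^ 'm) measure"
    and \<Phi> :: "real ^ 'd \<Rightarrow> real ^ 'm \<Rightarrow> real ^ 'd"
    and \<phi> :: "real ^ 'd \<Rightarrow> real ^ 'm \<Rightarrow> real"
    and \<mu> :: "(real ^ 'm) measure"
    and q :: "'n \<Rightarrow> real ^ 'm \<Rightarrow> real"
    and \<nu> :: "(real ^ 'n) measure"
    and p :: "real ^ 'n \<Rightarrow> real"
    and \<theta>\<^sub>c :: "real ^ 'n"
    and r\<^sub>c \<alpha> :: real
    and L\<^sub>\<Phi> L\<^sub>\<phi> :: "'n \<Rightarrow> real"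
    and \<theta>hat :: "nat \<Rightarrow> (nat \<Rightarrow> real ^ 'm) \<Rightarrow> real ^ 'n"
  assumes X: "X \<noteq> {}" "closed X" "convex X"
    and Q: "\<And>j. prob_space (Q j)" "\<And>j. sets (Q j) = sets (restrict_space borel \<Xi>)"
    and \<Phi>_cont: "\<And>\<xi>. \<xi> \<in> \<Xi> \<Longrightarrow> continuous_on X (\<lambda>x. \<Phi> x \<xi>)"
    and \<Phi>_int: "\<And>x j. x \<in> X \<Longrightarrow> integrable (Q j) (\<Phi> x)"
    and \<phi>_cont: "\<And>\<xi>. \<xi> \<in> \<Xi> \<Longrightarrow> continuous_on X (\<lambda>x. \<phi> x \<xi>)"
    and \<phi>_int: "\<And>x j. x \<in> X \<Longrightarrow> integrable (Q j) (\<phi> x)"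
    and \<mu>: "sigma_finite_measure \<mu>" "sets \<mu> = sets (restrict_space borel \<Xi>)"
    and q: "\<And>j. q j \<in> borel_measurable \<mu>" "\<And>j \<xi>. \<xi> \<in> \<Xi> \<Longrightarrow> 0 \<le> q j \<xi>"
    and Q_density: "\<And>j. Q j = density \<mu> (\<lambda>\<xi>. ennreal (q j \<xi>))"
    and identifiable: "inj_on (mixture \<Xi> Q) prob_simplex"
    and \<theta>\<^sub>c: "\<theta>\<^sub>c \<in> prob_simplex"
    and r\<^sub>c: "0 \<le> r\<^sub>c"
    and \<alpha>: "0 < \<alpha>" "\<alpha> < 1"
    and \<nu>: "sets \<nu> = sets (restrict_space borel (prob_simplex :: (real ^ 'n) set))"
    and prior: "p \<in> borel_measurable \<nu>" "\<And>\<theta>. \<theta> \<in> prob_simplex \<Longrightarrow> 0 \<le> p \<theta>"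
      "prob_space (density \<nu> (\<lambda>\<theta>. ennreal (p \<theta>)))"
    and MLE: "\<And>N \<omega>. 1 \<le> N \<Longrightarrow> \<omega> \<in> space (\<Pi>\<^sub>M i\<in>(UNIV::nat set). mixture \<Xi> Q \<theta>\<^sub>c) \<Longrightarrow>
      is_arg_max (likelihood q N \<omega>) (\<lambda>\<theta>. \<theta> \<in> prob_simplex) (\<theta>hat N \<omega>)"
    and X_compact: "compact X"
    and i: "\<theta>\<^sub>c \<in> rel_interior prob_simplex"
    and ii: "AE \<omega> in (\<Pi>\<^sub>M i\<in>(UNIV::nat set). mixture \<Xi> Q \<theta>\<^sub>c).
      \<forall>N\<ge>1. C2_near (\<lambda>\<theta>. ln (likelihood q N \<omega> \<theta>)) \<theta>\<^sub>c"
    and iii: "invertible (fisher_information q (mixture \<Xi> Q \<theta>\<^sub>c) \<theta>\<^sub>c)"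
    and iv: "\<exists>U. open U \<and> \<theta>\<^sub>c \<in> U \<and> continuous_on (U \<inter> prob_simplex) p \<and>
      (\<forall>\<theta>\<in>U \<inter> prob_simplex. 0 < p \<theta>)"
    and v_g: "\<And>\<theta>. \<theta> \<in> prob_simplex \<Longrightarrow> \<exists>g. integrable (mixture \<Xi> Q \<theta>\<^sub>c) g \<and>
      (AE \<xi> in mixture \<Xi> Q \<theta>\<^sub>c. 0 < mix_density q \<theta> \<xi> \<and> \<bar>ln (mix_density q \<theta> \<xi>)\<bar> \<le> g \<xi>)"
    and v_p: "\<exists>c1 c2. 0 < c1 \<and> c1 < c2 \<and> (\<forall>\<theta>\<in>prob_simplex. c1 \<le> p \<theta> \<and> p \<theta> \<le> c2)"
    and vi: "\<And>j. 0 < L\<^sub>\<Phi> j" "\<And>j. (L\<^sub>\<Phi> j)-lipschitz_on X (\<lambda>x. \<integral>\<xi>. \<Phi> x \<xi> \<partial>Q j)"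
      "\<And>j. 0 < L\<^sub>\<phi> j" "\<And>j. (L\<^sub>\<phi> j)-lipschitz_on X (\<lambda>x. \<integral>\<xi>. \<phi> x \<xi> \<partial>Q j)"
  shows "AE \<omega> in (\<Pi>\<^sub>M i\<in>(UNIV::nat set). mixture \<Xi> Q \<theta>\<^sub>c).
    (\<lambda>N. Limsup (at_right 0) (\<lambda>lam. deviation
       (solution_set X Q \<Phi> \<phi> lam (\<theta>hat N \<omega>)
         (r\<^sub>c + delta_hat q \<alpha> N \<omega> (\<theta>hat N \<omega>)))
       (solution_set X Q \<Phi> \<phi> 0 \<theta>\<^sub>c r\<^sub>c)))
     \<longlonglongrightarrow> 0"
proof -
  interpret mixture_model \<Xi> Q \<mu> q \<theta>\<^sub>c
    by (rule mixture_model.intro[OF Q(1) \<mu>(2) q Q_density \<theta>\<^sub>c prob_simplex_rel_interior_pos[OF i]])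
  show ?thesis
    \<comment> \<open>\<open>AE_space\<close> is carried along because the maximum likelihood
      property is given for sample sequences in the space of the product measure.\<close>
    using AE_typical_sample AE_space
  proof eventually_elim
    case (elim \<omega>)
    interpret typical_sample \<Xi> Q \<mu> q \<theta>\<^sub>c \<omega>
      by (rule elim)
    have inv: "invertible information"
      using iii fisher_information_eq by simp
    have simplex: "\<theta>hat N \<omega> \<in> prob_simplex" if "1 \<le> N" for N
      using MLE[OF that elim(2)] by (simp add: is_arg_max_linorder)
    have lim: "(\<lambda>N. \<theta>hat N \<omega>) \<longlonglongrightarrow> \<theta>\<^sub>c"
    proof (rule maximum_likelihood_consistent[OF inv simplex])
      show "likelihood q N \<omega> \<theta>\<^sub>c \<le> likelihood q N \<omega> (\<theta>hat N \<omega>)" if "1 \<le> N" for N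
        using MLE[OF that elim(2)] \<theta>\<^sub>c by (simp add: is_arg_max_linorder)
    qed
    have "(\<lambda>N. delta_hat q \<alpha> N \<omega> (\<theta>hat N \<omega>)) \<longlonglongrightarrow> 0"
      by (rule delta_hat_tendsto_zero[OF observed_information_tendsto[OF lim] inv])
    then have rad: "(\<lambda>N. r\<^sub>c + delta_hat q \<alpha> N \<omega> (\<theta>hat N \<omega>)) \<longlonglongrightarrow> r\<^sub>c"
      using tendsto_add[OF tendsto_const[of r\<^sub>c]] by fastforce
    show ?case
    proof (rule Limsup_deviation_tendsto_zero[OF X_compact lipschitz_on_continuous_on[OF vi(2)]
          lipschitz_on_continuous_on[OF vi(4)] lim _ rad])
      \<comment> \<open>Membership holds from \<open>N = 1\<close> on; the value at
        \<open>N = 0\<close> is arbitrary.\<close>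
      show "\<forall>\<^sub>F N in sequentially. \<theta>hat N \<omega> \<in> prob_simplex"
        using simplex unfolding eventually_sequentially by blast
    qed
  qed
qed

end
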